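(* Let $V,W$ be non-degenerate rank-1 words, with associated rank-1 systems $(X,\sigma)$ and $(Y,\sigma)$ respectively. Then $V$ is isomorphic to $W$ (i.e., there exists a topological isomorphism $\phi:X\to Y$) if and only if there is a replacement scheme $(v,w)$ for $V$ and $W$.
   Context: $\mathbb{N}$ includes $0$. $\mathcal{F}$ is the set of nonempty finite words over $\{0,1\}$ that begin and end with $0$. Juxtaposition denotes concatenation and $1^a$ is the word consisting of $a$ ones. An infinite word $V\in\{0,1\}^{\mathbb{N}}$ is built from $v\in\mathcal{F}$ if there is a sequence $(a_i)_{i\ge 1}$ of natural numbers with $V=v1^{a_1}v1^{a_2}v\cdots$. $V$ is rank-1 if it is built from infinitely many $v\in\mathcal{F}$. A rank-1 word $V$ is degenerate if $V=vvv\cdots$ for some finite word $v$, and non-degenerate otherwise. The rank-1 system associated to a rank-1 word $V$ is $(X,\sigma)$, where $X=\{x\in\{0,1\}^{\mathbb{Z}} : \text{every finite subword of } x \text{ is a subword of } V\}$ (with the subspace topology of the product topology) and $\sigma(x)(i)=x(i+1)$. A topological isomorphism from $(X,\sigma)$ to $(Y,\sigma)$ is a homeomorphism $\phi:X\to Y$ with $\phi\circ\sigma=\sigma\circ\phi$. If $V$ is built from $v$ and $v$ has exactly $r$ occurrences of $0$, then an occurrence of $v$ in $V$ beginning at position $i$ is called expected if $|\{j<i : V(j)=0\}|$ is a multiple of $r$ (so each $0$ of $V$ is part of exactly one expected occurrence of $v$). For non-degenerate rank-1 words $V,W$ and $v,w\in\mathcal{F}$, the pair $(v,w)$ is a replacement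 scheme for $V$ and $W$ if: (1) $V$ is built from $v$ and $W$ is built from $w$; and (2) for every $k\in\mathbb{N}$, $V$ has an expected occurrence of $v$ beginning at position $k$ iff $W$ has an expected occurrence of $w$ beginning at position $k$. *)

theory Defs
  imports "HOL-Analysis.Analysis"
begin

text \<open>
  The alphabet \<open>{0,1}\<close> is the type \<^typ>\<open>bool\<close>: \<^term>\<open>False\<close> is the letter 0 and \<^term>\<open>True\<close> is
  the letter 1. Finite words are lists, one-sided infinite words have type
  \<^typ>\<open>nat \<Rightarrow> bool\<close> and two-sided infinite words have type \<^typ>\<open>int \<Rightarrow> bool\<close>.
\<close>

definition FF :: "bool list set" where
  "FF = {v. v \<noteq> [] \<and> hd v = False \<and> last v = False}"

definition occurs_at :: "bool list \<Rightarrow> (nat \<Rightarrow> bool) \<Rightarrow> nat \<Rightarrow> bool" where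
  "occurs_at u V i \<longleftrightarrow> (\<forall>j<length u. V (i + j) = u ! j)"

definition occurs_at_bi :: "bool list \<Rightarrow> (int \<Rightarrow> bool) \<Rightarrow> int \<Rightarrow> bool" where
  "occurs_at_bi u x i \<longleftrightarrow> (\<forall>j<length u. x (i + int j) = u ! j)"

text \<open>
  \<open>V = u 0 u 1 u 2 \<dots>\<close>, stated as: every finite concatenation \<open>u 0 \<dots> u (n - 1)\<close> is a
  prefix of \<open>V\<close>. This determines \<open>V\<close> when infinitely many \<open>u n\<close> are nonempty; below,
  all of them are.
\<close>
definition is_infinite_concat :: "(nat \<Rightarrow> bool list) \<Rightarrow> (nat \<Rightarrow> bool) \<Rightarrow> bool" where
  "is_infinite_concat u V \<longleftrightarrow> (\<forall>n. occurs_at (concat (map u [0..<n])) V 0)"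

definition built_from :: "(nat \<Rightarrow> bool) \<Rightarrow> bool list \<Rightarrow> bool" where
  "built_from V v \<longleftrightarrow>
     v \<in> FF \<and> (\<exists>a :: nat \<Rightarrow> nat. is_infinite_concat (\<lambda>i. v @ replicate (a i) True) V)"

definition rank_one :: "(nat \<Rightarrow> bool) \<Rightarrow> bool" where
  "rank_one V \<longleftrightarrow> infinite {v. built_from V v}"

definition degenerate :: "(nat \<Rightarrow> bool) \<Rightarrow> bool" where
  "degenerate V \<longleftrightarrow> (\<exists>v. v \<noteq> [] \<and> is_infinite_concat (\<lambda>_. v) V)"

definition system_space :: "(nat \<Rightarrow> bool) \<Rightarrow> (int \<Rightarrow> bool) set" where
  "system_space V = {x. \<forall>u. (\<exists>i. occurs_at_bi u x i) \<longrightarrow> (\<exists>k. occurs_at u V k)}"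

definition shift :: "(int \<Rightarrow> bool) \<Rightarrow> (int \<Rightarrow> bool)" where
  "shift x = (\<lambda>i. x (i + 1))"

text \<open>
  The topology on \<^typ>\<open>int \<Rightarrow> bool\<close> is the type class instance for functions, that is, the
  product topology, with the discrete topology on \<^typ>\<open>bool\<close>. The constant
  \<^const>\<open>homeomorphism\<close> uses the subspace topologies on its two set arguments.
\<close>
definition isomorphic_systems :: "(int \<Rightarrow> bool) set \<Rightarrow> (int \<Rightarrow> bool) set \<Rightarrow> bool" where
  "isomorphic_systems X Y \<longleftrightarrow>
     (\<exists>\<phi> \<psi>. homeomorphism X Y \<phi> \<psi> \<and> (\<forall>x\<in>X. \<phi> (shift x) = shift (\<phi> x)))"

text \<open>Only meaningful when \<open>V\<close> is built from \<open>v\<close>.\<close>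
definition expected_occurrence :: "(nat \<Rightarrow> bool) \<Rightarrow> bool list \<Rightarrow> nat \<Rightarrow> bool" where
  "expected_occurrence V v i \<longleftrightarrow>
     occurs_at v V i \<and> count_list v False dvd card {j. j < i \<and> V j = False}"

definition replacement_scheme ::
  "(nat \<Rightarrow> bool) \<Rightarrow> (nat \<Rightarrow> bool) \<Rightarrow> bool list \<Rightarrow> bool list \<Rightarrow> bool" where
  "replacement_scheme V W v w \<longleftrightarrow>
     built_from V v \<and> built_from W w \<and>
     (\<forall>k. expected_occurrence V v k \<longleftrightarrow> expected_occurrence W w k)"

end

theory Submission
  imports Defs
begin

text \<open>
  A replacement scheme lets one pass between the two systems by a block code: non-degeneracy makes
  the expected occurrences of \<open>v\<close> recognizable from a bounded window, and \<open>w\<close> is written in their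
  place. Conversely, an isomorphism is given by a block code, and the point is to see that some
  shift of it carries \<open>V\<close> to \<open>W\<close>. If \<open>V\<close> has arbitrarily long runs of ones, \<open>\<dots>111V\<close> is, up to shift,
  the only point other than \<open>\<dots>111\<dots>\<close> that is left asymptotic to it, and the same holds for \<open>W\<close>.
  Otherwise there are two distinct points that both end in \<open>V\<close>, while any two distinct right
  asymptotic points of the other system end in \<open>W\<close>. Once \<open>V\<close> and \<open>W\<close> correspond under a block code, a
  counting argument on sufficiently long building words produces the scheme.
\<close>

section \<open>Positions of zeros and building words\<close>

text \<open>A building word of \<open>V\<close> is determined by its number \<open>r\<close> of
  zeros, and its expected occurrences by the positions \<open>zpos V (r * i)\<close>. A replacement
  scheme is thus an equality of two sets of positions, and the argument is arithmetic on indices of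
  zeros rather than on words. The obstacle in the converse is that an isomorphism knows only the
  two-sided systems, in which the one-sided word \<open>V\<close> is not a point; it must be located
  by properties that a shift-commuting homeomorphism preserves. Being asymptotic is such a property,
  and so is the case distinction: long runs of ones exist exactly if the constant point 1 lies in
  the system, where it is the only fixed point. The image of a point reading \<open>V\<close> from 0
  on then reads \<open>W\<close> from some \<open>p\<close> on, and a larger radius of the block
  code absorbs \<open>p\<close>. What remains is a rule computing letters of \<open>W\<close> from
  windows of \<open>V\<close>. It says nothing about the first letters of \<open>W\<close>, and
  windows that cross the end of a block are not controlled by the block; long building words make up
  for both losses.\<close>

definition zpos :: "(nat \<Rightarrow> bool) \<Rightarrow> nat \<Rightarrow> nat" where
  "zpos V = enumerate {i. \<not> V i}"

definition zcount :: "(nat \<Rightarrow> bool) \<Rightarrow> nat \<Rightarrow> nat" where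
  "zcount V i = card {j. j < i \<and> \<not> V j}"

text \<open>
  \<open>blocks V r\<close> expresses that \<open>V\<close> is built from its prefix ending at its \<open>r\<close>-th zero; the positions
  \<open>zpos V (r * i)\<close> are then the expected occurrences of that prefix.
\<close>

definition blocks :: "(nat \<Rightarrow> bool) \<Rightarrow> nat \<Rightarrow> bool" where
  "blocks V r \<longleftrightarrow> 0 < r \<and> (\<forall>i t. t < r \<longrightarrow> zpos V (r * i + t) = zpos V (r * i) + zpos V t)"

lemma zcount_Suc: "zcount V (Suc i) = zcount V i + (if V i then 0 else 1)"
proof -
  have "{j. j < Suc i \<and> \<not> V j} = (if V i then {} else {i}) \<union> {j. j < i \<and> \<not> V j}"
    by (auto simp: less_Suc_eq)
  then show ?thesis by (simp add: zcount_def)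
qed

lemma zcount_0 [simp]: "zcount V 0 = 0"
  by (simp add: zcount_def)

lemma zcount_add: "zcount V (x + j) = zcount V x + zcount (\<lambda>i. V (x + i)) j"
  by (induction j) (simp_all add: zcount_Suc)

lemma zcount_cong: "(\<And>j. j < l \<Longrightarrow> V j = W j) \<Longrightarrow> zcount V l = zcount W l"
  unfolding zcount_def by (rule arg_cong[where f = card]) auto

lemma zcount_mono: "i \<le> j \<Longrightarrow> zcount V i \<le> zcount V j"
  unfolding zcount_def by (rule card_mono) auto

lemma zcount_strict: "\<not> V i \<Longrightarrow> i < j \<Longrightarrow> zcount V i < zcount V j"
  using zcount_mono[of "Suc i" j V] by (simp add: zcount_Suc)

lemma zcount_inj: "\<not> V i \<Longrightarrow> \<not> V j \<Longrightarrow> zcount V i = zcount V j \<Longrightarrow> i = j"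
  using zcount_strict[of V i j] zcount_strict[of V j i] by (metis less_irrefl linorder_neqE_nat)

lemma zpos_strict_mono: "infinite {i. \<not> V i} \<Longrightarrow> strict_mono (zpos V)"
  unfolding zpos_def by (rule strict_mono_enumerate)

lemma zpos_zero: "infinite {i. \<not> V i} \<Longrightarrow> \<not> V (zpos V n)"
  unfolding zpos_def using enumerate_in_set by blast

lemma zcount_zpos:
  assumes "infinite {i. \<not> V i}" shows "zcount V (zpos V n) = n"
proof -
  have lt: "zpos V i < zpos V j \<longleftrightarrow> i < j" for i j
    using strict_mono_less[OF zpos_strict_mono[OF assms]] .
  have "{j. j < zpos V n \<and> \<not> V j} = zpos V ` {..<n}"
  proof (rule set_eqI)
    fix j
    have "\<not> V j \<longleftrightarrow> (\<exists>m. j = zpos V m)"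
      using enumerate_Ex[OF assms, of j] zpos_zero[OF assms] unfolding zpos_def by auto
    then show "j \<in> {j. j < zpos V n \<and> \<not> V j} \<longleftrightarrow> j \<in> zpos V ` {..<n}"
      using lt by auto
  qed
  moreover have "inj_on (zpos V) {..<n}"
    using lt by (metis inj_onI less_irrefl linorder_neqE_nat)
  ultimately show ?thesis by (simp add: zcount_def card_image)
qed

lemma zpos_zcount: "infinite {i. \<not> V i} \<Longrightarrow> \<not> V i \<Longrightarrow> zpos V (zcount V i) = i"
  by (metis zcount_inj zcount_zpos zpos_zero)

lemma zpos_eqI: "infinite {i. \<not> V i} \<Longrightarrow> \<not> V i \<Longrightarrow> zcount V i = n \<Longrightarrow> zpos V n = i"
  using zpos_zcount by blast

text \<open>This converts equal windows into equal zero positions. Both windows open at a zero, so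
  by \<open>zcount_add\<close> the indices of corresponding zeros differ by the constant
  \<open>m - a\<close>.\<close>

lemma zpos_transport:
  assumes inf: "infinite {i. \<not> V i}"
    and eq: "\<And>j. j < l \<Longrightarrow> V (x + j) = V (y + j)"
    and x: "zpos V m = x" and y: "zpos V a = y" and l: "zpos V (a + n) < y + l"
  shows "zpos V (m + n) = x + (zpos V (a + n) - y)"
proof -
  let ?j = "zpos V (a + n) - y"
  have "y \<le> zpos V (a + n)"
    using y strict_mono_less_eq[OF zpos_strict_mono[OF inf]] by auto
  then have yj: "y + ?j = zpos V (a + n)" and j: "?j < l" using l by auto
  have z: "\<not> V (x + ?j)" using eq[OF j] yj zpos_zero[OF inf] by metis
  have "zcount (\<lambda>i. V (x + i)) ?j = zcount (\<lambda>i. V (y + i)) ?j"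
    by (rule zcount_cong) (use j eq in auto)
  moreover have "zcount V (y + ?j) = a + n" using yj zcount_zpos[OF inf] by metis
  ultimately have "zcount V (x + ?j) = m + n"
    using zcount_add[of V x ?j] zcount_add[of V y ?j] zcount_zpos[OF inf, of a] zcount_zpos[OF inf, of m] x y by simp
  then show ?thesis using z zpos_eqI[OF inf] by blast
qed

lemma zpos_gap:
  assumes inf: "infinite {i. \<not> V i}" and "zpos V n < i" "i < zpos V (Suc n)"
  shows "V i"
proof (rule ccontr)
  assume "\<not> V i"
  then obtain m where "zpos V m = i" using zpos_zcount[OF inf] by blast
  then have "n < m" "m < Suc n" using assms strict_mono_less[OF zpos_strict_mono[OF inf]] by auto
  then show False by simp
qed

text \<open>The offsets \<open>e\<close> are left open because they are partial sums when
  \<open>V\<close> is taken apart, but \<open>zpos V (r * n)\<close> when it is put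
  together.\<close>

lemma is_infinite_concat_iff:
  assumes e0: "e 0 = 0" and eS: "\<And>n. e (Suc n) = e n + length (u n)"
  shows "is_infinite_concat u V \<longleftrightarrow> (\<forall>n. occurs_at (u n) V (e n))"
proof -
  have len: "length (concat (map u [0..<n])) = e n" for n
    by (induction n) (simp_all add: e0 eS)
  have step: "occurs_at (concat (map u [0..<Suc n])) V 0 \<longleftrightarrow>
    occurs_at (concat (map u [0..<n])) V 0 \<and> occurs_at (u n) V (e n)" for n
  proof -
    have app: "occurs_at (x @ y) V 0 \<longleftrightarrow> occurs_at x V 0 \<and> occurs_at y V (length x)" for x y
    proof 
      assume *: "occurs_at (x @ y) V 0"
      have "V (length x + j) = y ! j" if "j < length y" for j
        using that *[unfolded occurs_at_def, rule_format, of "length x + j"] by simp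
      moreover have "V j = x ! j" if "j < length x" for j
        using that *[unfolded occurs_at_def, rule_format, of j] by (simp add: nth_append)
      ultimately show "occurs_at x V 0 \<and> occurs_at y V (length x)" by (simp add: occurs_at_def)
    next
      assume *: "occurs_at x V 0 \<and> occurs_at y V (length x)"
      have "V j = (x @ y) ! j" if "j < length x + length y" for j
        using * that unfolding occurs_at_def
        by (cases "j < length x") (auto simp: nth_append dest!: spec[of _ "j - length x"])
      then show "occurs_at (x @ y) V 0" by (simp add: occurs_at_def)
    qed
    show ?thesis by (simp add: app len)
  qed
  have "occurs_at (concat (map u [0..<n])) V 0 \<longleftrightarrow> (\<forall>m<n. occurs_at (u m) V (e m))" for n
  proof (induction n)
    case 0 then show ?case by (simp add: occurs_at_def)
  next
    case (Suc n) then show ?case unfolding step by (auto simp: less_Suc_eq)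
  qed
  then show ?thesis unfolding is_infinite_concat_def by blast
qed

lemma zcount_count: "zcount (\<lambda>i. v ! i) (length v) = count_list v False"
proof (induction v rule: rev_induct)
  case (snoc b v)
  have "zcount ((!) (v @ [b])) (length v) = zcount ((!) v) (length v)"
    by (rule zcount_cong) (simp add: nth_append)
  then show ?case using snoc by (simp add: zcount_Suc)
qed simp

lemma FF_iff: "v \<in> FF \<longleftrightarrow> v \<noteq> [] \<and> \<not> v ! 0 \<and> \<not> v ! (length v - 1)"
  unfolding FF_def by (auto simp: hd_conv_nth last_conv_nth)

text \<open>The last clause makes \<open>v\<close> a function of its number of zeros; infinitely
  many building words therefore give arbitrarily large \<open>r\<close>.\<close>

lemma built_fromD:
  assumes "built_from V v" and r: "r = count_list v False"
  shows "infinite {i. \<not> V i}" "\<not> V 0" "blocks V r" "v = map V [0..<Suc (zpos V (r - 1))]"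
proof -
  from assms obtain a where v: "v \<in> FF"
    and c: "is_infinite_concat (\<lambda>i. v @ replicate (a i) True) V"
    unfolding built_from_def by blast
  have vz: "v \<noteq> []" "\<not> v ! 0" "\<not> v ! (length v - 1)" using v FF_iff by auto
  define e where "e n = (\<Sum>j<n. length v + a j)" for n
  have e: "e 0 = 0" "e (Suc n) = e n + (length v + a n)" for n by (simp_all add: e_def)
  have "occurs_at (v @ replicate (a n) True) V (e n)" for n
    using c is_infinite_concat_iff[of e "\<lambda>i. v @ replicate (a i) True" V] e by simp
  then have occ: "V (e n + j) = (v @ replicate (a n) True) ! j" if "j < length v + a n" for n j
    using that by (simp add: occurs_at_def)
  have ov: "V (e n + j) = v ! j" if "j < length v" for n j
    using occ[of j n] that by (simp add: nth_append)
  have o1: "V (e n + length v + j)" if "j < a n" for n j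
    using occ[of "length v + j" n] that by (simp add: nth_append add.assoc)
  have V0: "V j = v ! j" if "j < length v" for j using ov[OF that, of 0] e by simp
  show z0: "\<not> V 0" using V0[of 0] vz by simp
  have sm: "strict_mono e" using vz by (intro strict_monoI_Suc) (simp add: e)
  have ze: "\<not> V (e n)" for n using ov[of 0 n] vz by simp
  have "range e \<subseteq> {i. \<not> V i}" using ze by auto
  moreover have "infinite (range e)"
    using sm by (simp add: finite_image_iff strict_mono_imp_inj_on)
  ultimately show inf: "infinite {i. \<not> V i}" using infinite_super by blast
  have czv: "zcount V (length v) = r" using zcount_count[of v] V0 r zcount_cong[of "length v" V "(!) v"] by simp
  have cze: "zcount V (e n) = r * n" for n
  proof (induction n)
    case (Suc n)
    have "zcount (\<lambda>i. V (e n + length v + i)) (a n) = 0"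
      using o1[of _ n] by (simp add: zcount_def)
    moreover have "zcount (\<lambda>i. V (e n + i)) (length v) = r"
      using zcount_cong[of "length v" "\<lambda>i. V (e n + i)" "(!) v"] ov[of _ n] zcount_count[of v] r by simp
    ultimately show ?case
      using Suc zcount_add[of V "e n" "length v"] zcount_add[of V "e n + length v" "a n"]
      by (simp add: e add.assoc)
  qed (simp add: e)
  have rpos: "0 < r" using czv zcount_strict[of V 0 "length v"] z0 vz by simp
  have zt: "zpos V t < length v" if "t < r" for t
    using that czv zcount_zpos[OF inf, of t] zcount_mono[of "length v" "zpos V t" V] by (metis not_less)
  have "zpos V (r * n + t) = e n + zpos V t" if "t < r" for n t
  proof (rule zpos_eqI[OF inf])
    show "\<not> V (e n + zpos V t)" using zt[OF that] ov V0 zpos_zero[OF inf] by metis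
    have "zcount (\<lambda>i. V (e n + i)) (zpos V t) = zcount V (zpos V t)"
      by (rule zcount_cong) (use zt[OF that] ov V0 in simp)
    then show "zcount V (e n + zpos V t) = r * n + t" using zcount_add[of V "e n"] cze zcount_zpos[OF inf] by simp
  qed
  moreover have "zpos V 0 = 0" using zpos_eqI[OF inf z0] by simp
  ultimately show "blocks V r" using rpos by (metis blocks_def add.right_neutral)
  have "zcount V (length v - 1) = r - 1"
    using czv zcount_Suc[of V "length v - 1"] V0[of "length v - 1"] vz by simp
  then have "zpos V (r - 1) = length v - 1"
    using zpos_eqI[OF inf] V0[of "length v - 1"] vz by simp
  then show "v = map V [0..<Suc (zpos V (r - 1))]"
    using vz V0 by (intro nth_equalityI) auto
qed

lemma blocks_last:
  "blocks V r \<Longrightarrow> zpos V (r * n + (r - 1)) = zpos V (r * n) + zpos V (r - 1)"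
  unfolding blocks_def using diff_less zero_less_one by blast

lemma blocks_copy:
  assumes inf: "infinite {i. \<not> V i}" and b: "blocks V r" and j: "j \<le> zpos V (r - 1)"
  shows "V (zpos V (r * n) + j) = V j"
proof -
  have sm: "strict_mono (zpos V)" by (rule zpos_strict_mono[OF inf])
  have r: "0 < r" and bl: "\<And>i t. t < r \<Longrightarrow> zpos V (r * i + t) = zpos V (r * i) + zpos V t"
    using b by (auto simp: blocks_def)
  have "\<not> V (zpos V (r * n) + j) \<longleftrightarrow> \<not> V j"
  proof
    assume "\<not> V j"
    then obtain t where t: "zpos V t = j" using zpos_zcount[OF inf] by blast
    then have "t < r" using j r strict_mono_less_eq[OF sm, of t "r - 1"] by simp
    then show "\<not> V (zpos V (r * n) + j)" using bl t zpos_zero[OF inf] by metis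
  next
    assume "\<not> V (zpos V (r * n) + j)"
    then obtain s where s: "zpos V s = zpos V (r * n) + j" using zpos_zcount[OF inf] by blast
    have "zpos V (r * n) \<le> zpos V s" "zpos V s \<le> zpos V (r * n + (r - 1))"
      unfolding blocks_last[OF b] using s j by auto
    then have "r * n \<le> s" "s \<le> r * n + (r - 1)" using strict_mono_less_eq[OF sm] by auto
    then have "s = r * n + (s - r * n)" "s - r * n < r" using r by auto
    then obtain t where "s = r * n + t" "t < r" by blast
    then have "zpos V t = j" using s bl by simp
    then show "\<not> V j" using zpos_zero[OF inf] by blast
  qed
  then show ?thesis by blast
qed

lemma blocks_gap:
  assumes inf: "infinite {i. \<not> V i}" and b: "blocks V r"
    and j: "zpos V (r * n) + zpos V (r - 1) < j" "j < zpos V (r * Suc n)"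
  shows "V j"
proof (rule zpos_gap[OF inf])
  show "zpos V (r * n + (r - 1)) < j" unfolding blocks_last[OF b] using j(1) .
  have "Suc (r * n + (r - 1)) = r * Suc n" using b by (simp add: blocks_def)
  then show "j < zpos V (Suc (r * n + (r - 1)))" using j(2) by metis
qed

lemma blocks_next:
  assumes inf: "infinite {i. \<not> V i}" and b: "blocks V r"
  shows "zpos V (r * n) + zpos V (r - 1) < zpos V (r * Suc n)"
proof -
  have "r * n + (r - 1) < r * Suc n" using b by (auto simp: blocks_def)
  then have "zpos V (r * n + (r - 1)) < zpos V (r * Suc n)"
    using strict_mono_less[OF zpos_strict_mono[OF inf]] by blast
  then show ?thesis unfolding blocks_last[OF b] .
qed

lemma built_fromI:
  assumes inf: "infinite {i. \<not> V i}" and z0: "\<not> V 0" and b: "blocks V r"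
  defines "v \<equiv> map V [0..<Suc (zpos V (r - 1))]"
  shows "built_from V v" "count_list v False = r"
proof -
  define a where "a n = zpos V (r * Suc n) - zpos V (r * n) - length v" for n
  have zp0: "zpos V 0 = 0" using zpos_eqI[OF inf z0] by simp
  have lv: "length v = Suc (zpos V (r - 1))" by (simp add: v_def)
  have nx: "zpos V (r * Suc n) = zpos V (r * n) + (length v + a n)" for n
    using blocks_next[OF inf b, of n] by (simp add: a_def lv)
  have vn: "v ! j = V j" if "j < length v" for j using that by (simp add: v_def del: upt_Suc)
  have "is_infinite_concat (\<lambda>i. v @ replicate (a i) True) V"
  proof (subst is_infinite_concat_iff[of "\<lambda>n. zpos V (r * n)"])
    show "\<forall>n. occurs_at (v @ replicate (a n) True) V (zpos V (r * n))"
      unfolding occurs_at_def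
    proof (intro allI impI)
      fix n j assume j: "j < length (v @ replicate (a n) True)"
      show "V (zpos V (r * n) + j) = (v @ replicate (a n) True) ! j"
      proof (cases "j < length v")
        case True
        then show ?thesis using blocks_copy[OF inf b, of j n] vn by (simp add: nth_append lv)
      next
        case False
        then have "V (zpos V (r * n) + j)"
          using blocks_gap[OF inf b, of n "zpos V (r * n) + j"] j nx[of n] lv by simp
        then show ?thesis using False j by (simp add: nth_append)
      qed
    qed
  qed (use nx zp0 in auto)
  moreover have "v \<in> FF" unfolding FF_iff using lv vn z0 zpos_zero[OF inf] by auto
  ultimately show "built_from V v" unfolding built_from_def by blast
  have "zcount V (length v) = r"
    using zcount_Suc[of V "zpos V (r - 1)"] zpos_zero[OF inf] zcount_zpos[OF inf] b lv by (simp add: blocks_def)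
  then show "count_list v False = r"
    using zcount_count[of v] zcount_cong[of "length v" "(!) v" V] vn by simp
qed

lemma expected_iff:
  assumes "built_from V v" "r = count_list v False"
  shows "expected_occurrence V v k \<longleftrightarrow> k \<in> range (\<lambda>i. zpos V (r * i))"
proof -
  note B = built_fromD[OF assms]
  have vn: "v ! j = V j" if "j < length v" for j
    using that by (subst B(4)) (subst (asm) B(4), simp del: upt_Suc)
  have lv: "length v = Suc (zpos V (r - 1))" by (subst B(4)) simp
  have e: "expected_occurrence V v k \<longleftrightarrow> occurs_at v V k \<and> r dvd zcount V k"
    unfolding expected_occurrence_def zcount_def assms(2) by simp
  show ?thesis
  proof
    assume "expected_occurrence V v k"
    then have o: "occurs_at v V k" and d: "r dvd zcount V k" using e by auto
    have "\<not> V k" using o[unfolded occurs_at_def, rule_format, of 0] lv vn[of 0] B(2) by simp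
    then have "k = zpos V (zcount V k)" using zpos_zcount[OF B(1)] by simp
    then show "k \<in> range (\<lambda>i. zpos V (r * i))" using d by (auto elim!: dvdE)
  next
    assume "k \<in> range (\<lambda>i. zpos V (r * i))"
    then obtain i where k: "k = zpos V (r * i)" by blast
    have "occurs_at v V k" unfolding occurs_at_def k
      using blocks_copy[OF B(1,3), of _ i] lv vn by simp
    then show "expected_occurrence V v k" using e k zcount_zpos[OF B(1)] by simp
  qed
qed

text \<open>The last assumption is what non-degeneracy is used for.\<close>

locale nd_word =
  fixes V :: "nat \<Rightarrow> bool"
  assumes start: "\<not> V 0"
    and inf: "infinite {i. \<not> V i}"
    and large_blocks: "\<exists>r>n. blocks V r"
    and gaps_vary: "blocks V r \<Longrightarrow> \<exists>i. zpos V (r * Suc i) \<noteq> zpos V (r * i) + zpos V r"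

text \<open>If all consecutive blocks started at distance \<open>zpos V r\<close>, then
  \<open>V\<close> would repeat its prefix of that length and be degenerate.\<close>

lemma nd_wordI:
  assumes "rank_one V" "\<not> degenerate V"
  shows "nd_word V"
proof -
  obtain v where "built_from V v" using assms(1) unfolding rank_one_def
    by (metis (mono_tags) Collect_empty_eq finite.emptyI)
  note B = built_fromD[OF this refl]
  show ?thesis
  proof
    show "\<not> V 0" "infinite {i. \<not> V i}" using B by auto
    show "\<exists>r>n. blocks V r" for n
    proof -
      have "inj_on (\<lambda>v. count_list v False) {v. built_from V v}"
        by (rule inj_onI) (metis built_fromD(4) mem_Collect_eq)
      then have "infinite ((\<lambda>v. count_list v False) ` {v. built_from V v})"
        using assms(1) by (simp add: rank_one_def finite_image_iff)
      then obtain r where "r > n" "r \<in> (\<lambda>v. count_list v False) ` {v. built_from V v}"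
        by (meson infinite_nat_iff_unbounded)
      then show ?thesis using built_fromD(3) by blast
    qed
    fix r assume b: "blocks V r"
    show "\<exists>i. zpos V (r * Suc i) \<noteq> zpos V (r * i) + zpos V r"
    proof (rule ccontr)
      assume "\<not> ?thesis"
      then have eq: "zpos V (r * Suc i) = zpos V (r * i) + zpos V r" for i by blast
      let ?u = "map V [0..<zpos V r]"
      have zp0: "zpos V 0 = 0" using zpos_eqI[OF B(1,2)] by simp
      have "is_infinite_concat (\<lambda>_. ?u) V"
      proof (subst is_infinite_concat_iff[of "\<lambda>n. zpos V (r * n)"])
        show "\<forall>n. occurs_at ?u V (zpos V (r * n))" unfolding occurs_at_def
        proof (intro allI impI)
          fix n j assume "j < length ?u"
          then have j: "j < zpos V r" by simp
          have "V (zpos V (r * n) + j) = V j"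
          proof (cases "j \<le> zpos V (r - 1)")
            case False
            then show ?thesis using j eq[of n] zp0 blocks_gap[OF B(1) b, of 0 j]
                blocks_gap[OF B(1) b, of n "zpos V (r * n) + j"] by simp
          qed (use blocks_copy[OF B(1) b] in auto)
          then show "V (zpos V (r * n) + j) = ?u ! j" using j by simp
        qed
      qed (use eq zp0 in auto)
      moreover have "?u \<noteq> []"
        using b strict_mono_less[OF zpos_strict_mono[OF B(1)], of 0 r] by (auto simp: blocks_def)
      ultimately show False using assms(2) unfolding degenerate_def by blast
    qed
  qed
qed

section \<open>Recognizing expected occurrences in a non-degenerate word\<close>

context nd_word begin

lemma zpos_0 [simp]: "zpos V 0 = 0"
  using zpos_eqI[OF inf start] by simp

lemma zpos_less [simp]: "zpos V m < zpos V n \<longleftrightarrow> m < n"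
  using strict_mono_less[OF zpos_strict_mono[OF inf]] .

lemma zpos_le [simp]: "zpos V m \<le> zpos V n \<longleftrightarrow> m \<le> n"
  using strict_mono_less_eq[OF zpos_strict_mono[OF inf]] .

lemma zpos_eq [simp]: "zpos V m = zpos V n \<longleftrightarrow> m = n"
  using strict_mono_eq[OF zpos_strict_mono[OF inf]] .

lemma zpos_ge: "n \<le> zpos V n"
  using strict_mono_imp_increasing[OF zpos_strict_mono[OF inf]] .

lemma zero_iff: "\<not> V i \<longleftrightarrow> (\<exists>n. i = zpos V n)"
  using zpos_zcount[OF inf] zpos_zero[OF inf] by metis

lemma zpos_nonzero [simp]: "\<not> V (zpos V n)"
  using zpos_zero[OF inf] .

lemma large_zp_blocks: "\<exists>r. blocks V r \<and> n \<le> zpos V (r - 1)"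
proof -
  obtain r where "r > n" "blocks V r" using large_blocks by blast
  moreover have "n \<le> zpos V (r - 1)" using zpos_ge[of "r - 1"] \<open>r > n\<close> by simp
  ultimately show ?thesis by blast
qed

lemma blocksD: "blocks V r \<Longrightarrow> 0 < r"
  "blocks V r \<Longrightarrow> t < r \<Longrightarrow> zpos V (r * i + t) = zpos V (r * i) + zpos V t"
  by (auto simp: blocks_def)

text \<open>
  If the two parses of \<open>V\<close> were out of phase, each gap between consecutive blocks would be read
  off from one fixed gap inside a block, so all of them would be equal up to the bound \<open>L\<close>.
\<close>

lemma recognizable:
  assumes b: "blocks V r"
  shows "\<exists>L. \<forall>k. (\<forall>j. zpos V (r - 1) \<le> j \<and> j < L \<longrightarrow> V (k + j) = V j) \<longrightarrow> k \<in> range (\<lambda>i. zpos V (r * i))"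
proof -
  have r: "0 < r" using blocksD[OF b] by simp
  obtain i0 where i0: "zpos V (r * Suc i0) \<noteq> zpos V (r * i0) + zpos V r" using gaps_vary[OF b] by blast
  \<comment> \<open>The window ends just after the zero opening block \<open>Suc i0\<close>, so it
    shows the exceptional gap as well as the first one.\<close>
  define L where "L = Suc (zpos V (r * Suc i0))"
  have "k \<in> range (\<lambda>i. zpos V (r * i))"
    if eq: "\<And>j. zpos V (r - 1) \<le> j \<Longrightarrow> j < L \<Longrightarrow> V (k + j) = V j" for k
  proof -
    have "zpos V (r - 1) < L" using r by (simp add: L_def less_Suc_eq_le)
    then have "\<not> V (k + zpos V (r - 1))" using eq[of "zpos V (r - 1)"] by simp
    then obtain m where m: "k + zpos V (r - 1) = zpos V m" using zero_iff by blast
    define t where "t = m mod r"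
    define s where "s = m div r"
    have mt: "m = r * s + t" and tr: "t < r" using r by (simp_all add: t_def s_def)
    have tp: "zpos V (m + n) = k + zpos V (r - 1 + n)" if "r - 1 + n \<le> r * Suc i0" for n
    proof -
      have "zpos V (r - 1 + n) < L" using that by (simp add: L_def less_Suc_eq_le)
      then have "zpos V (m + n) = zpos V m + (zpos V (r - 1 + n) - zpos V (r - 1))"
        using zpos_transport[OF inf, of "L - zpos V (r - 1)" "zpos V m" "zpos V (r - 1)" m "r - 1" n]
          eq[of "zpos V (r - 1) + _"] m[symmetric] by (simp add: add.assoc)
      moreover have "zpos V (r - 1) \<le> zpos V (r - 1 + n)" by simp
      ultimately show ?thesis using m by simp
    qed
    have "t = r - 1"
    proof (rule ccontr)
      assume "t \<noteq> r - 1"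
      then have t1: "Suc t < r" using tr by simp
      have "zpos V (r * Suc i) = zpos V (r * i) + (zpos V (r - 1) + zpos V (Suc t) - zpos V t)"
        if "i \<le> i0" for i
      proof -
        have le: "r * Suc i \<le> r * Suc i0" using that by simp
        have ix: "r - 1 + r * i = r * i + (r - 1)" "r - 1 + Suc (r * i) = r * Suc i"
          "m + r * i = r * (s + i) + t" "m + Suc (r * i) = r * (s + i) + Suc t"
          using r mt by (simp_all add: algebra_simps)
        have 1: "zpos V (r * (s + i) + t) = k + (zpos V (r * i) + zpos V (r - 1))"
        proof -
          have "r * i + (r - 1) \<le> r * Suc i" using r by auto
          then have "r - 1 + r * i \<le> r * Suc i0" using le unfolding ix by (rule order_trans)
          from tp[OF this] show ?thesis unfolding ix blocks_last[OF b] .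
        qed
        have 2: "zpos V (r * (s + i) + Suc t) = k + zpos V (r * Suc i)"
          using tp[of "Suc (r * i)"] le unfolding ix by simp
        show ?thesis using 1 2 blocksD(2)[OF b tr, of "s + i"] blocksD(2)[OF b t1, of "s + i"]
            zpos_less[of t "Suc t"] by linarith
      qed
      from this[of 0] this[of i0] show False using i0 by simp
    qed
    then have "zpos V m = zpos V (r * s) + zpos V (r - 1)" using blocksD(2)[OF b tr, of s] mt by simp
    then have "k = zpos V (r * s)" using m by simp
    then show ?thesis by blast
  qed
  then show ?thesis by blast
qed

end

section \<open>Replacement schemes from local rules\<close>

text \<open>
  Choose a word \<open>w\<close> building \<open>W\<close> that is long compared with \<open>N\<close>, and a word \<open>v\<close> building \<open>V\<close> that is
  much longer still. By recognizability every expected occurrence of \<open>v\<close> in \<open>V\<close> is one of \<open>w\<close> in \<open>W\<close>. Since ones are mapped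
  to ones, the last \<open>w\<close> before the next expected \<open>v\<close> starts inside the part of \<open>W\<close> determined by \<open>v\<close>,
  so the number of copies of \<open>w\<close> between consecutive expected \<open>v\<close>'s is constant; grouping them
  gives the second word of the scheme.
\<close>

lemma replacement_scheme_of_local_rule:
  assumes "nd_word V" "nd_word W"
    and rule: "\<And>i i'. (\<And>j. j \<le> 2 * N \<Longrightarrow> V (i + j) = V (i' + j)) \<Longrightarrow> W (i + N) = W (i' + N)"
    and ones: "\<And>i. (\<And>j. j \<le> 2 * N \<Longrightarrow> V (i + j)) \<Longrightarrow> W (i + N)"
  shows "\<exists>v w. replacement_scheme V W v w"
proof -
  interpret V: nd_word V by fact
  interpret W: nd_word W by fact
  \<comment> \<open>One copy of \<open>w\<close> has to contain its zero of index
    \<open>2 * N\<close> and \<open>N\<close> further letters; the proof of \<open>C\<close> needs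
    this room.\<close>
  obtain r where r: "blocks W r" and rN: "zpos W (2 * N) + N \<le> zpos W (r - 1)"
    using W.large_zp_blocks by blast
  have r0: "0 < r" using W.blocksD(1)[OF r] .
  have "zpos W (2 * N) \<le> zpos W (r - 1)" using rN by linarith
  then have Nr: "2 * N < r" using r0 by auto
  obtain L where L: "\<And>k. (\<And>j. zpos W (r - 1) \<le> j \<Longrightarrow> j < L \<Longrightarrow> W (k + j) = W j) \<Longrightarrow>
      k \<in> range (\<lambda>i. zpos W (r * i))"
    using W.recognizable[OF r] by meson
  obtain s where s: "blocks V s" and sL: "L + zpos W r + N \<le> zpos V (s - 1)"
    using V.large_zp_blocks by blast
  define l where "l = Suc (zpos V (s - 1))"
  define k where "k i = zpos V (s * i)" for i
  have A: "W (k i + j) = W j" if j: "N \<le> j" "j + N < l" for i j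
  proof -
    have "W (k i + (j - N) + N) = W (j - N + N)"
    proof (rule rule)
      fix d assume "d \<le> 2 * N"
      then have "(j - N) + d \<le> zpos V (s - 1)" using j by (simp add: l_def)
      then show "V (k i + (j - N) + d) = V (j - N + d)"
        using blocks_copy[OF V.inf s, of "(j - N) + d" i] by (simp add: k_def add.assoc)
    qed
    then show ?thesis using j by simp
  qed
  have Nz: "N \<le> zpos W (r - 1)" using rN by simp
  \<comment> \<open>The rule does not reach the first \<open>N\<close> letters after
    \<open>k i\<close>. \<open>recognizable\<close> tolerates this: it asks for agreement only from
    the last zero of the block on, which comes at \<open>N\<close> or later.\<close>
  have "k i \<in> range (\<lambda>n. zpos W (r * n))" for i
    by (rule L, rule A) (use Nz sL in \<open>auto simp: l_def\<close>)
  then have "\<exists>m. k i = zpos W (r * m)" for i by blast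
  then obtain m where m: "\<And>i. k i = zpos W (r * m i)" by metis
  have B: "W (k i + j) = W j" if "j + N < l" for i j
  proof (cases "N \<le> j")
    case False
    then show ?thesis using blocks_copy[OF W.inf r, of j "m i"] Nz m by simp
  qed (use A that in auto)
  have kS: "k i + l \<le> k (Suc i)" for i
    using blocks_next[OF V.inf s, of i] by (simp add: k_def l_def)
  have mS: "m i < m (Suc i)" for i
  proof -
    have "k i < k (Suc i)" using kS[of i] by (simp add: l_def)
    then show ?thesis using m by simp
  qed
  \<comment> \<open>Counted from \<open>k i\<close>, this is the index of the zero opening the last
    copy of \<open>w\<close> before \<open>k (Suc i)\<close>.\<close>
  define D where "D i = r * (m (Suc i) - m i - 1)" for i
  have Dm: "r * m i + D i = r * (m (Suc i) - 1)" "r * m i + D i + r = r * m (Suc i)" for i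
  proof -
    obtain n where n: "m (Suc i) = Suc (m i + n)" using mS[of i] less_imp_Suc_add by blast
    show "r * m i + D i = r * (m (Suc i) - 1)" "r * m i + D i + r = r * m (Suc i)"
      unfolding D_def n by (simp_all add: algebra_simps)
  qed
  have C: "zpos W (r * m i + D i) + N < k i + l" for i
  proof (rule ccontr)
    assume far: "\<not> ?thesis"
    \<comment> \<open>This zero lies at least \<open>2 * N\<close> letters after the start of the
      last copy, so \<open>?q - N\<close> is past the end of \<open>v\<close>, while
      \<open>rN\<close> keeps \<open>?q + N\<close> before \<open>k (Suc i)\<close>. Hence
      \<open>V\<close> has only ones around \<open>?q\<close>.\<close>
    let ?q = "zpos W (r * m i + D i + 2 * N)"
    have q: "?q = zpos W (r * m i + D i) + zpos W (2 * N)"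
      unfolding Dm(1) using W.blocksD(2)[OF r Nr] .
    have "zpos W (r * m i + D i) + zpos W (r - 1) < k (Suc i)"
      using blocks_next[OF W.inf r, of "m (Suc i) - 1"] mS[of i] unfolding Dm(1) m by simp
    then have q2: "?q + N < k (Suc i)" using q rN by simp
    have q1: "k i + l \<le> ?q - N" "N \<le> ?q" using q far W.zpos_ge[of "2 * N"] by auto
    have "W (?q - N + N)"
    proof (rule ones)
      fix j assume j: "j \<le> 2 * N"
      show "V (?q - N + j)"
        using blocks_gap[OF V.inf s, of i "?q - N + j"] q1 q2 j by (simp add: k_def l_def)
    qed
    then show False using q1 by simp
  qed
  have mk: "zpos W (r * m i) = k i" for i using m by simp
  have up: "zpos W (r * m i + n) = k i + zpos W n" if "zpos W n + N < l" for i n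
  proof -
    have "zpos W (r * m i + n) = k i + (zpos W (0 + n) - 0)"
      by (rule zpos_transport[OF W.inf, where l = "l - N"]) (use B mk that in auto)
    then show ?thesis by simp
  qed
  have D0: "zpos W (D i) + N < l" for i
  proof -
    have ge: "k i \<le> zpos W (r * m i + D i)" unfolding m by simp
    have "zpos W (0 + D i) = 0 + (zpos W (r * m i + D i) - k i)"
    proof (rule zpos_transport[OF W.inf, where l = "l - N"])
      show "W (0 + j) = W (k i + j)" if "j < l - N" for j using B[of j i] that by simp
      show "zpos W (r * m i + D i) < k i + (l - N)" using C[of i] by simp
    qed (simp_all add: mk)
    then show ?thesis using C[of i] ge by simp
  qed
  have le: "D i' \<le> D i" for i i'
  proof (rule ccontr)
    assume "\<not> ?thesis"
    \<comment> \<open>The values of \<open>D\<close> are multiples of \<open>r\<close>, so a larger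
      one exceeds \<open>D i\<close> by a whole copy of \<open>w\<close>. The zero of relative index
      \<open>D i'\<close> would then lie at or beyond \<open>k (Suc i)\<close>, although it belongs
      to the part copied from the prefix.\<close>
    then have "Suc (m (Suc i) - m i - 1) \<le> m (Suc i') - m i' - 1"
      unfolding D_def by (simp only: not_le Suc_le_eq nat_mult_less_cancel1 mult_less_cancel1)
    from mult_le_mono2[OF this, of r] have "D i + r \<le> D i'"
      unfolding D_def by (simp only: mult_Suc_right add.commute)
    then have "k (Suc i) \<le> zpos W (r * m i + D i')" unfolding m Dm(2)[of i, symmetric] by simp
    also have "\<dots> = k i + zpos W (D i')" using up[OF D0] .
    finally show False using D0[of i'] kS[of i] by simp
  qed
  have DD: "D i = D 0" for i using le[of i 0] le[of 0 i] by simp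
  define M where "M = m 1"
  have "k 0 = 0" by (simp add: k_def)
  then have m0: "m 0 = 0" using m[of 0] r0 W.zpos_eq[of 0 "r * m 0"] by simp
  have R: "r * M = D 0 + r" using Dm(2)[of 0] m0 by (simp add: M_def)
  have mM: "r * m i = r * M * i" for i
  proof (induction i)
    case (Suc i)
    then show ?case using Dm(2)[of i] DD[of i] R by simp
  qed (simp add: m0)
  have b: "blocks W (r * M)"
    unfolding blocks_def
  proof (intro conjI allI impI)
    show "0 < r * M" using R r0 by simp
    fix i t assume t: "t < r * M"
    show "zpos W (r * M * i + t) = zpos W (r * M * i) + zpos W t"
    proof (cases "t \<le> D 0")
      case True
      then have "zpos W t + N < l" using D0[of 0] W.zpos_le[of t "D 0"] by linarith
      then show ?thesis using up[of t i] m[of i] by (simp add: mM)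
    next
      case False
      define u where "u = t - D 0"
      have u: "t = D 0 + u" "u < r" using False t R by (auto simp: u_def)
      have "zpos W (r * m i + D i + u) = zpos W (r * m i + D i) + zpos W u"
        unfolding Dm(1) using W.blocksD(2)[OF r u(2)] .
      moreover have "zpos W (D 0 + u) = zpos W (D 0) + zpos W u"
        unfolding D_def using W.blocksD(2)[OF r u(2)] .
      moreover have "zpos W (r * m i + D 0) = k i + zpos W (D 0)" using up[OF D0] .
      ultimately show ?thesis using u m[of i] DD[of i] by (simp add: mM add.assoc)
    qed
  qed
  note v = built_fromI[OF V.inf V.start s] and w = built_fromI[OF W.inf W.start b]
  have "zpos V (s * i) = zpos W (r * M * i)" for i
    using m[of i] mM[of i] by (simp add: k_def)
  then have "replacement_scheme V W (map V [0..<Suc (zpos V (s - 1))]) (map W [0..<Suc (zpos W (r * M - 1))])"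
    unfolding replacement_scheme_def
    using v w expected_iff[OF v(1) v(2)[symmetric]] expected_iff[OF w(1) w(2)[symmetric]] by simp
  then show ?thesis by blast
qed

section \<open>Block codes\<close>

text \<open>Centred windows suffice since every finite subword lies in one. The bound
  \<open>k \<ge> int M\<close> keeps \<open>nat\<close> from truncating.\<close>

lemma system_spaceI:
  assumes "\<And>M::nat. \<exists>k\<ge>int M. \<forall>d. \<bar>d\<bar> \<le> int M \<longrightarrow> x d = V (nat (k + d))"
  shows "x \<in> system_space V"
  unfolding system_space_def
proof (intro CollectI allI impI)
  fix u assume "\<exists>i. occurs_at_bi u x i"
  then obtain i where i: "occurs_at_bi u x i" by blast
  obtain k where k: "k \<ge> int (length u + nat \<bar>i\<bar>)"
    "\<And>d. \<bar>d\<bar> \<le> int (length u + nat \<bar>i\<bar>) \<Longrightarrow> x d = V (nat (k + d))"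
    using assms by blast
  have "occurs_at u V (nat (k + i))" unfolding occurs_at_def
  proof (intro allI impI)
    fix j assume j: "j < length u"
    have "nat (k + i) + j = nat (k + (i + int j))" using k(1) j by linarith
    moreover have "\<bar>i + int j\<bar> \<le> int (length u + nat \<bar>i\<bar>)" using j by linarith
    ultimately show "V (nat (k + i) + j) = u ! j"
      using k(2)[of "i + int j"] i j by (simp add: occurs_at_bi_def)
  qed
  then show "\<exists>k. occurs_at u V k" by blast
qed

lemma system_spaceE:
  fixes M :: nat
  assumes "x \<in> system_space V"
  obtains k where "k \<ge> int M" "\<And>d. \<bar>d\<bar> \<le> int M \<Longrightarrow> x (i + d) = V (nat (k + d))"
proof -
  let ?u = "map (\<lambda>j. x (i - int M + int j)) [0..<2 * M + 1]"
  have "occurs_at_bi ?u x (i - int M)" by (simp add: occurs_at_bi_def del: upt_Suc)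
  then obtain k where k: "occurs_at ?u V k" using assms unfolding system_space_def by blast
  show thesis
  proof
    show "int (k + M) \<ge> int M" by simp
    fix d :: int assume d: "\<bar>d\<bar> \<le> int M"
    then have "V (k + nat (int M + d)) = x (i - int M + int (nat (int M + d)))"
      using k[unfolded occurs_at_def, rule_format, of "nat (int M + d)"]
      by (auto simp del: upt_Suc)
    moreover have "k + nat (int M + d) = nat (int (k + M) + d)" using d by linarith
    moreover have "i - int M + int (nat (int M + d)) = i + d" using d by linarith
    ultimately show "x (i + d) = V (nat (int (k + M) + d))" by simp
  qed
qed

text \<open>A block code of radius \<open>M\<close>. Allowing different positions \<open>i\<close>
  and \<open>j\<close> builds commutation with the shift into the notion.\<close>

definition sliding :: "(int \<Rightarrow> bool) set \<Rightarrow> nat \<Rightarrow> ((int \<Rightarrow> bool) \<Rightarrow> int \<Rightarrow> bool) \<Rightarrow> bool" where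
  "sliding S M F \<longleftrightarrow> (\<forall>x\<in>S. \<forall>y\<in>S. \<forall>i j.
     (\<forall>d. \<bar>d\<bar> \<le> int M \<longrightarrow> x (i + d) = y (j + d)) \<longrightarrow> F x i = F y j)"

lemma slidingD:
  "sliding S M F \<Longrightarrow> x \<in> S \<Longrightarrow> y \<in> S \<Longrightarrow>
    (\<And>d. \<bar>d\<bar> \<le> int M \<Longrightarrow> x (i + d) = y (j + d)) \<Longrightarrow> F x i = F y j"
  unfolding sliding_def by blast

text \<open>The one-sided word enters as \<open>\<lambda>i. V (nat i)\<close>, whose left half is
  the constant \<open>V 0\<close>; for \<open>k \<ge> int M\<close> the window around
  \<open>k\<close> does not reach into that artificial half.\<close>

lemma sliding_window:
  assumes F: "sliding UNIV M F" and VW: "\<And>k. k \<ge> int M \<Longrightarrow> F (\<lambda>i. V (nat i)) k = W (nat k)"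
    and k: "k \<ge> int (M + n)" "\<And>d. \<bar>d\<bar> \<le> int (M + n) \<Longrightarrow> x (i + d) = V (nat (k + d))"
    and d: "\<bar>d\<bar> \<le> int n"
  shows "F x (i + d) = W (nat (k + d))"
proof -
  have "F x (i + d) = F (\<lambda>i. V (nat i)) (k + d)"
  proof (rule slidingD[OF F UNIV_I UNIV_I])
    fix d' :: int assume "\<bar>d'\<bar> \<le> int M"
    then show "x (i + d + d') = V (nat (k + d + d'))" using k(2)[of "d + d'"] d by (simp add: add.assoc)
  qed
  also have "\<dots> = W (nat (k + d))" using VW[of "k + d"] k(1) d by simp
  finally show ?thesis .
qed

lemma sliding_maps:
  assumes "sliding UNIV M F" and "\<And>k. k \<ge> int M \<Longrightarrow> F (\<lambda>i. V (nat i)) k = W (nat k)"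
    and x: "x \<in> system_space V"
  shows "F x \<in> system_space W"
proof (rule system_spaceI)
  fix n
  obtain k where k: "k \<ge> int (M + n)" "\<And>d. \<bar>d\<bar> \<le> int (M + n) \<Longrightarrow> x (0 + d) = V (nat (k + d))"
    using system_spaceE[OF x] by metis
  have "F x d = W (nat (k + d))" if "\<bar>d\<bar> \<le> int n" for d
    using sliding_window[OF assms(1,2) k that] by simp
  then show "\<exists>k\<ge>int n. \<forall>d. \<bar>d\<bar> \<le> int n \<longrightarrow> F x d = W (nat (k + d))"
    using k(1) by (intro exI[of _ k]) auto
qed

lemma sliding_inverse:
  assumes F: "sliding UNIV M F" and VW: "\<And>k. k \<ge> int M \<Longrightarrow> F (\<lambda>i. V (nat i)) k = W (nat k)"
    and G: "sliding UNIV M' G" and WV: "\<And>k. k \<ge> int M' \<Longrightarrow> G (\<lambda>i. W (nat i)) k = V (nat k)"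
    and x: "x \<in> system_space V"
  shows "G (F x) = x"
proof
  fix i
  obtain k where k: "k \<ge> int (M + M')"
      "\<And>d. \<bar>d\<bar> \<le> int (M + M') \<Longrightarrow> x (i + d) = V (nat (k + d))"
    using system_spaceE[OF x] by metis
  have "G (F x) i = G (\<lambda>i. W (nat i)) k"
    by (rule slidingD[OF G UNIV_I UNIV_I]) (rule sliding_window[OF F VW k])
  also have "\<dots> = x i" using WV[of k] k(1) k(2)[of 0] by simp
  finally show "G (F x) i = x i" .
qed

lemma open_coordinate: "open {x :: int \<Rightarrow> bool. x i = b}"
proof -
  have "open ((\<lambda>x::int \<Rightarrow> bool. x i) -` {b})"
    by (rule open_vimage) (auto intro: open_discrete)
  then show ?thesis by (simp add: vimage_def)
qed

lemma sliding_continuous: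
  assumes F: "sliding UNIV M F" shows "continuous_on S F"
proof (rule continuous_on_coordinatewise_then_product)
  fix i
  have "open ((\<lambda>x. F x i) -` B)" for B
  proof (subst open_subopen, intro ballI)
    fix x assume x: "x \<in> (\<lambda>x. F x i) -` B"
    let ?T = "\<Inter>d\<in>{- int M..int M}. {y :: int \<Rightarrow> bool. y (i + d) = x (i + d)}"
    have "open ?T" by (intro open_INT ballI open_coordinate) auto
    moreover have "?T \<subseteq> (\<lambda>x. F x i) -` B"
    proof
      fix y assume "y \<in> ?T"
      then have "y (i + d) = x (i + d)" if "\<bar>d\<bar> \<le> int M" for d
        using that by (auto simp: abs_le_iff)
      then have "F y i = F x i" by (rule slidingD[OF F UNIV_I UNIV_I])
      then show "y \<in> (\<lambda>x. F x i) -` B" using x by simp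
    qed
    ultimately show "\<exists>T. open T \<and> x \<in> T \<and> T \<subseteq> (\<lambda>x. F x i) -` B" by blast
  qed
  then have "continuous_on UNIV (\<lambda>x. F x i)"
    by (simp add: continuous_on_open_vimage)
  then show "continuous_on S (\<lambda>x. F x i)" using continuous_on_subset by blast
qed

lemma isomorphic_if_sliding:
  assumes F: "sliding UNIV M F" and VW: "\<And>k. k \<ge> int M \<Longrightarrow> F (\<lambda>i. V (nat i)) k = W (nat k)"
    and G: "sliding UNIV M' G" and WV: "\<And>k. k \<ge> int M' \<Longrightarrow> G (\<lambda>i. W (nat i)) k = V (nat k)"
  shows "isomorphic_systems (system_space V) (system_space W)"
  unfolding isomorphic_systems_def
proof (intro exI conjI ballI)
  show "homeomorphism (system_space V) (system_space W) F G"
    using sliding_maps[OF F VW] sliding_maps[OF G WV]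
      sliding_inverse[OF F VW G WV] sliding_inverse[OF G WV F VW]
      sliding_continuous[OF F] sliding_continuous[OF G]
    by (intro homeomorphismI) auto
  show "F (shift x) = shift (F x)" for x
    unfolding shift_def
    by (rule ext, rule slidingD[OF F UNIV_I UNIV_I]) (simp add: algebra_simps)
qed

section \<open>Local detection of expected occurrences and decoding\<close>

context nd_word begin

text \<open>If the zero at \<open>d\<close> has index \<open>n\<close>, the one at
  \<open>p + d\<close> has index \<open>r * m + n\<close>, and \<open>r\<close> divides both or
  neither.\<close>

lemma expected_relative:
  assumes b: "blocks V r" and p: "p \<in> range (\<lambda>i. zpos V (r * i))"
    and eq: "\<And>t. t < L \<Longrightarrow> V (p + t) = V t" and d: "d < L"
  shows "p + d \<in> range (\<lambda>i. zpos V (r * i)) \<longleftrightarrow> d \<in> range (\<lambda>i. zpos V (r * i))"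
proof -
  obtain m where m: "p = zpos V (r * m)" using p by blast
  have tr: "zpos V (r * m + n) = p + zpos V n" if "zpos V n < L" for n
  proof -
    have "zpos V (r * m + n) = p + (zpos V (0 + n) - 0)"
      by (rule zpos_transport[OF inf, where l = L]) (use eq m that in auto)
    then show ?thesis by simp
  qed
  show ?thesis
  proof
    assume "p + d \<in> range (\<lambda>i. zpos V (r * i))"
    then obtain i where i: "p + d = zpos V (r * i)" by blast
    then have "\<not> V d" using eq[OF d] zpos_nonzero by metis
    then obtain n where n: "d = zpos V n" using zero_iff by blast
    then have "r * m + n = r * i" using tr[of n] d i by simp
    then have "r dvd n" by (metis dvd_add_right_iff dvd_triv_left)
    then show "d \<in> range (\<lambda>i. zpos V (r * i))" using n by (auto elim: dvdE)
  next
    assume "d \<in> range (\<lambda>i. zpos V (r * i))"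
    then obtain i where i: "d = zpos V (r * i)" by blast
    then have "p + d = zpos V (r * (m + i))" using tr[of "r * i"] d by (simp add: distrib_left)
    then show "p + d \<in> range (\<lambda>i. zpos V (r * i))" by blast
  qed
qed

text \<open>An expected occurrence need not be followed by the long prefix that
  \<open>recognizable\<close> asks for. It does lie in a copy of a longer block, at some offset
  \<open>d\<close> from a position where a prefix of length \<open>L\<close> is read. That position
  is expected by \<open>recognizable\<close>, so it only remains to test \<open>d\<close> inside the
  prefix.\<close>

lemma expected_local:
  assumes b: "blocks V r"
  shows "\<exists>L. \<forall>K. K \<in> range (\<lambda>i. zpos V (r * i)) \<longleftrightarrow>
    (\<exists>d<L. d \<le> K \<and> d \<in> range (\<lambda>i. zpos V (r * i)) \<and> (\<forall>t<L. V (K - d + t) = V t))"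
proof -
  let ?E = "range (\<lambda>i. zpos V (r * i))"
  obtain L0 where L0: "\<And>k. (\<And>j. zpos V (r - 1) \<le> j \<Longrightarrow> j < L0 \<Longrightarrow> V (k + j) = V j) \<Longrightarrow> k \<in> ?E"
    using recognizable[OF b] by meson
  obtain r2 where r2: "blocks V r2" and L2: "L0 \<le> zpos V (r2 - 1)" using large_zp_blocks by blast
  define L where "L = Suc (zpos V (r2 - 1))"
  have E: "p \<in> ?E" if "\<And>t. t < L \<Longrightarrow> V (p + t) = V t" for p
    by (rule L0) (use that L2 in \<open>auto simp: L_def\<close>)
  have "K \<in> ?E \<longleftrightarrow> (\<exists>d<L. d \<le> K \<and> d \<in> ?E \<and> (\<forall>t<L. V (K - d + t) = V t))" for K
  proof
    assume K: "K \<in> ?E"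
    then obtain n where n: "K = zpos V n" by blast
    define d where "d = zpos V (n mod r2)"
    have pd: "K = zpos V (r2 * (n div r2)) + d"
      using blocksD[OF r2] n by (metis d_def mod_less_divisor mult_div_mod_eq)
    have "n mod r2 \<le> r2 - 1" using mod_less_divisor[OF blocksD(1)[OF r2], of n] by linarith
    then have d: "d < L" by (simp add: d_def L_def less_Suc_eq_le)
    have eq: "V (zpos V (r2 * (n div r2)) + t) = V t" if "t < L" for t
      using blocks_copy[OF inf r2] that by (simp add: L_def)
    have "d \<in> ?E" using expected_relative[OF b E[OF eq] eq d] K pd by simp
    then show "\<exists>d<L. d \<le> K \<and> d \<in> ?E \<and> (\<forall>t<L. V (K - d + t) = V t)"
      using d eq pd by (intro exI[of _ d]) auto
  next
    assume "\<exists>d<L. d \<le> K \<and> d \<in> ?E \<and> (\<forall>t<L. V (K - d + t) = V t)"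
    then obtain d where d: "d < L" "d \<le> K" "d \<in> ?E" "\<And>t. t < L \<Longrightarrow> V (K - d + t) = V t" by blast
    then show "K \<in> ?E" using expected_relative[OF b E, of "K - d" L d] by simp
  qed
  then show ?thesis by blast
qed

text \<open>Each zero lies in a copy of the block, so a letter is 1 unless a copy starting shortly
  before puts a 0 there. The bound on \<open>K\<close> keeps \<open>K - j\<close> from being
  truncated.\<close>

lemma decode:
  assumes b: "blocks V r" and K: "zpos V (r - 1) \<le> K"
  shows "V K \<longleftrightarrow> (\<forall>j\<le>zpos V (r - 1). K - j \<in> range (\<lambda>i. zpos V (r * i)) \<longrightarrow> V j)"
proof
  assume V: "V K"
  show "\<forall>j\<le>zpos V (r - 1). K - j \<in> range (\<lambda>i. zpos V (r * i)) \<longrightarrow> V j"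
  proof (intro allI impI)
    fix j assume j: "j \<le> zpos V (r - 1)" "K - j \<in> range (\<lambda>i. zpos V (r * i))"
    then obtain i where i: "K - j = zpos V (r * i)" by blast
    then show "V j" using blocks_copy[OF inf b j(1), of i] V j(1) K by (simp add: i[symmetric])
  qed
next
  assume *: "\<forall>j\<le>zpos V (r - 1). K - j \<in> range (\<lambda>i. zpos V (r * i)) \<longrightarrow> V j"
  show "V K"
  proof (rule ccontr)
    assume "\<not> V K"
    then obtain n where n: "K = zpos V n" using zero_iff by blast
    have pd: "K = zpos V (r * (n div r)) + zpos V (n mod r)"
      using blocksD[OF b] n by (metis mod_less_divisor mult_div_mod_eq)
    have "n mod r \<le> r - 1" using mod_less_divisor[OF blocksD(1)[OF b], of n] by linarith
    moreover have "K - zpos V (n mod r) \<in> range (\<lambda>i. zpos V (r * i))"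
      by (rule range_eqI[of _ _ "n div r"]) (use pd in simp)
    ultimately have "V (zpos V (n mod r))" using *[rule_format, of "zpos V (n mod r)"] by simp
    then show False by simp
  qed
qed

end

lemma recoding_exists:
  assumes "nd_word V" "nd_word W" and b: "blocks V r" "blocks W s"
    and E: "range (\<lambda>i. zpos V (r * i)) = range (\<lambda>i. zpos W (s * i))"
  shows "\<exists>M F. sliding UNIV M F \<and> (\<forall>k\<ge>int M. F (\<lambda>i. V (nat i)) k = W (nat k))"
proof -
  interpret V: nd_word V by fact
  interpret W: nd_word W by fact
  let ?E = "range (\<lambda>i. zpos V (r * i))"
  obtain L where L: "\<forall>K. K \<in> ?E \<longleftrightarrow>
      (\<exists>d<L. d \<le> K \<and> d \<in> ?E \<and> (\<forall>t<L. V (K - d + t) = V t))"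
    using V.expected_local[OF b(1)] by (rule exE)
  define l where "l = zpos W (s - 1)"
  \<comment> \<open>This is \<open>decode\<close> for \<open>W\<close>, with the condition that
    \<open>i - j\<close> is expected replaced by the test from \<open>expected_local\<close> for
    \<open>V\<close>. The coordinates inspected lie within \<open>l + L\<close> of
    \<open>i\<close>.\<close>
  define F where "F x i \<longleftrightarrow> (\<forall>j\<le>l. (\<exists>d<L. d \<in> ?E \<and> (\<forall>t<L. x (i - int j - int d + int t) = V t)) \<longrightarrow> W j)"
    for x :: "int \<Rightarrow> bool" and i
  have "sliding UNIV (l + L) F" unfolding sliding_def
  proof (intro ballI allI impI)
    fix x y :: "int \<Rightarrow> bool" and i j
    assume *: "\<forall>d. \<bar>d\<bar> \<le> int (l + L) \<longrightarrow> x (i + d) = y (j + d)"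
    have "x (i - int j' - int d + int t) = y (j - int j' - int d + int t)"
      if "j' \<le> l" "d < L" "t < L" for j' d t
      using *[rule_format, of "- int j' - int d + int t"] that by (simp add: add_diff_eq diff_add_eq)
    then show "F x i = F y j" unfolding F_def by (simp cong: conj_cong imp_cong)
  qed
  moreover have "F (\<lambda>i. V (nat i)) k = W (nat k)" if k: "k \<ge> int (l + L)" for k
  proof -
    have "(\<exists>d<L. d \<in> ?E \<and> (\<forall>t<L. V (nat (k - int j - int d + int t)) = V t)) \<longleftrightarrow> nat k - j \<in> ?E"
      if "j \<le> l" for j
    proof -
      have "nat (k - int j - int d + int t) = nat k - j - d + t" if "d < L" for d t
        using k \<open>j \<le> l\<close> that by linarith
      moreover have "d \<le> nat k - j" if "d < L" for d using k \<open>j \<le> l\<close> that by linarith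
      ultimately show ?thesis by (subst L[rule_format]) auto
    qed
    then have "F (\<lambda>i. V (nat i)) k \<longleftrightarrow> (\<forall>j\<le>l. nat k - j \<in> ?E \<longrightarrow> W j)"
      unfolding F_def by simp
    also have "\<dots> \<longleftrightarrow> W (nat k)" unfolding E l_def
      by (rule W.decode[OF b(2), symmetric]) (use k in \<open>simp add: l_def\<close>)
    finally show ?thesis .
  qed
  ultimately show ?thesis by blast
qed

lemma isomorphic_if_replacement_scheme:
  assumes "nd_word V" "nd_word W" and s: "replacement_scheme V W v w"
  shows "isomorphic_systems (system_space V) (system_space W)"
proof -
  have v: "built_from V v" and w: "built_from W w" using s by (auto simp: replacement_scheme_def)
  have E: "range (\<lambda>i. zpos V (count_list v False * i)) = range (\<lambda>i. zpos W (count_list w False * i))"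
    using s expected_iff[OF v refl] expected_iff[OF w refl] unfolding replacement_scheme_def by blast
  note b = built_fromD(3)[OF v refl] built_fromD(3)[OF w refl]
  obtain M F where F: "sliding UNIV M F" "\<And>k. k \<ge> int M \<Longrightarrow> F (\<lambda>i. V (nat i)) k = W (nat k)"
    using recoding_exists[OF assms(1,2) b E] by blast
  obtain M' G where G: "sliding UNIV M' G" "\<And>k. k \<ge> int M' \<Longrightarrow> G (\<lambda>i. W (nat i)) k = V (nat k)"
    using recoding_exists[OF assms(2,1) b(2,1) E[symmetric]] by blast
  show ?thesis by (rule isomorphic_if_sliding[OF F G])
qed

section \<open>Factor maps\<close>

text \<open>Letters become the reals 0 and 1, and the product of the sets \<open>{0, 1}\<close> is
  compact by Tychonoff. A coordinate closer than 1 to its limit equals it.\<close>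

lemma pointwise_convergent_subsequence:
  fixes f :: "nat \<Rightarrow> int \<Rightarrow> bool"
  obtains x s where "strict_mono s" "\<And>i. \<forall>\<^sub>F n in sequentially. f (s n) i = x i"
proof -
  define g :: "nat \<Rightarrow> int \<Rightarrow> real" where "g n i = of_bool (f n i)" for n i
  let ?K = "PiE UNIV (\<lambda>_. {0, 1}) :: (int \<Rightarrow> real) set"
  have "compactin (product_topology (\<lambda>_::int. euclidean :: real topology) UNIV) ?K"
    unfolding compactin_PiE by (simp add: finite_imp_compact)
  then have "compact ?K" by (simp add: euclidean_product_topology)
  then have "seq_compact ?K" by (rule compact_imp_seq_compact)
  moreover have "g n \<in> ?K" for n by (auto simp: g_def)
  ultimately obtain z s where z: "z \<in> ?K" and s: "strict_mono s" "(g \<circ> s) \<longlonglongrightarrow> z"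
    unfolding seq_compact_def by metis
  have "\<forall>\<^sub>F n in sequentially. f (s n) i = (z i = 1)" for i
  proof -
    have "open ((\<lambda>y::int \<Rightarrow> real. y i) -` ball (z i) 1)"
      by (rule open_vimage) auto
    from topological_tendstoD[OF s(2) this]
    have "\<forall>\<^sub>F n in sequentially. dist (z i) (g (s n) i) < 1" by simp
    moreover have "z i \<in> {0, 1}" using z by (auto simp: PiE_iff)
    ultimately show ?thesis
      by (auto elim!: eventually_mono simp: g_def dist_real_def split: if_splits)
  qed
  then show thesis by (rule that[OF s(1)])
qed

lemma pointwise_tendsto:
  fixes f :: "nat \<Rightarrow> int \<Rightarrow> bool"
  assumes "\<And>i. \<forall>\<^sub>F n in sequentially. f n i = x i"
  shows "f \<longlonglongrightarrow> x"
proof -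
  have "limitin (product_topology (\<lambda>_. euclidean) UNIV) f x sequentially"
    unfolding limitin_componentwise
    using assms by (simp add: limitin_canonical_iff tendsto_discrete)
  then show ?thesis by (simp add: euclidean_product_topology limitin_canonical_iff)
qed

lemma pointwise_window:
  fixes f :: "nat \<Rightarrow> int \<Rightarrow> bool"
  assumes "\<And>i. \<forall>\<^sub>F n in sequentially. f n i = x i"
  shows "\<exists>n\<ge>m. \<forall>d. \<bar>d\<bar> \<le> int M \<longrightarrow> f n d = x d"
proof -
  have "\<forall>\<^sub>F n in sequentially. \<forall>d\<in>{- int M..int M}. f n d = x d"
    by (rule eventually_ball_finite) (use assms in auto)
  then have "\<forall>\<^sub>F n in sequentially. n \<ge> m \<and> (\<forall>d\<in>{- int M..int M}. f n d = x d)"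
    using eventually_ge_at_top[of m] by eventually_elim blast
  from eventually_happens'[OF sequentially_bot this]
  obtain n where "n \<ge> m" "\<forall>d\<in>{- int M..int M}. f n d = x d" by blast
  then show ?thesis by (intro exI[of _ n]) (auto simp: abs_le_iff)
qed

lemma pointwise_limit_in_space:
  assumes lim: "\<And>i. \<forall>\<^sub>F n in sequentially. f n i = x i" and f: "\<And>n. f n \<in> system_space V"
  shows "x \<in> system_space V"
proof (rule system_spaceI)
  fix M
  obtain n where n: "\<And>d. \<bar>d\<bar> \<le> int M \<Longrightarrow> f n d = x d" using pointwise_window[of f x 0 M] lim by blast
  obtain k where "k \<ge> int M" "\<And>d. \<bar>d\<bar> \<le> int M \<Longrightarrow> f n (0 + d) = V (nat (k + d))"
    using system_spaceE[OF f] by metis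
  then show "\<exists>k\<ge>int M. \<forall>d. \<bar>d\<bar> \<le> int M \<longrightarrow> x d = V (nat (k + d))" using n by auto
qed

lemma translate_in_space:
  assumes "x \<in> system_space V" shows "(\<lambda>i. x (i + k)) \<in> system_space V"
proof (rule system_spaceI)
  fix M
  obtain l where "l \<ge> int M" "\<And>d. \<bar>d\<bar> \<le> int M \<Longrightarrow> x (k + d) = V (nat (l + d))"
    using system_spaceE[OF assms] by metis
  then show "\<exists>l\<ge>int M. \<forall>d. \<bar>d\<bar> \<le> int M \<longrightarrow> x (d + k) = V (nat (l + d))"
    by (auto simp: add.commute)
qed

locale factor_map =
  fixes V W :: "nat \<Rightarrow> bool" and \<phi> :: "(int \<Rightarrow> bool) \<Rightarrow> int \<Rightarrow> bool"
  assumes cont: "continuous_on (system_space V) \<phi>"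
    and maps: "\<And>x. x \<in> system_space V \<Longrightarrow> \<phi> x \<in> system_space W"
    and shift: "\<And>x. x \<in> system_space V \<Longrightarrow> \<phi> (shift x) = shift (\<phi> x)"
begin

lemma translate:
  assumes "x \<in> system_space V"
  shows "\<phi> (\<lambda>i. x (i + k)) = (\<lambda>i. \<phi> x (i + k))"
proof -
  have nat: "\<phi> (\<lambda>i. x (i + int n)) = (\<lambda>i. \<phi> x (i + int n))" if x: "x \<in> system_space V" for x n
  proof (induction n)
    case (Suc n)
    have "\<phi> (\<lambda>i. x (i + int (Suc n))) = \<phi> (shift (\<lambda>i. x (i + int n)))"
      by (rule arg_cong[where f = \<phi>]) (simp add: shift_def ac_simps)
    also have "\<dots> = shift (\<lambda>i. \<phi> x (i + int n))"
      using shift[OF translate_in_space[OF x]] Suc by simp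
    finally show ?case by (simp add: shift_def ac_simps)
  qed simp
  show ?thesis
  proof (cases "k \<ge> 0")
    case True then show ?thesis using nat[OF assms, of "nat k"] by simp
  next
    case False
    let ?x = "\<lambda>i. x (i + k)"
    have "\<phi> x = (\<lambda>i. \<phi> ?x (i - k))"
      using nat[OF translate_in_space[OF assms, of k], of "nat (- k)"] False by simp
    then have "\<phi> x (i + k) = \<phi> ?x i" for i by (metis add_diff_cancel_right')
    then show ?thesis by auto
  qed
qed

text \<open>Curtis-Hedlund-Lyndon theorem. If no radius sufficed, there would be points agreeing up
  to distance \<open>n\<close> with images differing at 0; along a subsequence both converge to the
  same point, against continuity there.\<close>

lemma sliding_exists: "\<exists>N. sliding (system_space V) N \<phi>"
proof -
  let ?X = "system_space V"
  have "\<exists>N. \<forall>x\<in>?X. \<forall>y\<in>?X. (\<forall>d. \<bar>d\<bar> \<le> int N \<longrightarrow> x d = y d) \<longrightarrow> \<phi> x 0 = \<phi> y 0"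
  proof (rule ccontr)
    assume "\<not> ?thesis"
    then have "\<forall>N. \<exists>x y. x \<in> ?X \<and> y \<in> ?X \<and> (\<forall>d. \<bar>d\<bar> \<le> int N \<longrightarrow> x d = y d) \<and> \<phi> x 0 \<noteq> \<phi> y 0"
      by blast
    then obtain f g where fg: "\<And>n. f n \<in> ?X" "\<And>n. g n \<in> ?X"
        "\<And>n d. \<bar>d\<bar> \<le> int n \<Longrightarrow> f n d = g n d" "\<And>n. \<phi> (f n) 0 \<noteq> \<phi> (g n) 0"
      by metis
    obtain x s where s: "strict_mono s" and fx: "\<And>i. \<forall>\<^sub>F n in sequentially. f (s n) i = x i"
      using pointwise_convergent_subsequence[of f] by blast
    have gx: "\<forall>\<^sub>F n in sequentially. g (s n) i = x i" for i
      using fx[of i] eventually_ge_at_top[of "nat \<bar>i\<bar>"]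
    proof eventually_elim
      case (elim n)
      have "n \<le> s n" using strict_mono_imp_increasing[OF s] .
      then show ?case using fg(3)[of i "s n"] elim by simp
    qed
    have x: "x \<in> ?X" using pointwise_limit_in_space[of "\<lambda>n. f (s n)", OF fx fg(1)] .
    have lim: "\<forall>\<^sub>F n in sequentially. \<phi> (h n) 0 = \<phi> x 0"
      if h: "\<And>n. h n \<in> ?X" and hx: "\<And>i. \<forall>\<^sub>F n in sequentially. h n i = x i" for h
    proof -
      have "((\<lambda>n. \<phi> (h n)) \<longlongrightarrow> \<phi> x) sequentially"
        by (rule continuous_on_tendsto_compose[OF cont pointwise_tendsto[OF hx] x]) (use h in simp)
      from topological_tendstoD[OF this open_coordinate[of 0 "\<phi> x 0"]] show ?thesis by simp
    qed
    have "\<forall>\<^sub>F n::nat in sequentially. False"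
      using lim[of "\<lambda>n. f (s n)", OF fg(1) fx] lim[of "\<lambda>n. g (s n)", OF fg(2) gx]
      by eventually_elim (use fg(4) in blast)
    then show False by simp
  qed
  then obtain N where N: "\<forall>x\<in>?X. \<forall>y\<in>?X. (\<forall>d. \<bar>d\<bar> \<le> int N \<longrightarrow> x d = y d) \<longrightarrow> \<phi> x 0 = \<phi> y 0"
    by (rule exE)
  have "sliding ?X N \<phi>" unfolding sliding_def
  proof (intro ballI allI impI)
    fix x y i j
    assume xy: "x \<in> ?X" "y \<in> ?X" and eq: "\<forall>d. \<bar>d\<bar> \<le> int N \<longrightarrow> x (i + d) = y (j + d)"
    have "\<phi> (\<lambda>l. x (l + i)) 0 = \<phi> (\<lambda>l. y (l + j)) 0"
      by (rule N[rule_format]) (use xy eq in \<open>simp_all add: translate_in_space add.commute\<close>)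
    then show "\<phi> x i = \<phi> y j" using translate[OF xy(1), of i] translate[OF xy(2), of j] by simp
  qed
  then show ?thesis by blast
qed

end

section \<open>Long runs of ones and fixed points\<close>

definition syndetic_zeros :: "(nat \<Rightarrow> bool) \<Rightarrow> bool" where
  "syndetic_zeros V \<longleftrightarrow> (\<exists>B. \<forall>i. \<exists>j\<le>B. \<not> V (i + j))"

text \<open>This expresses the case distinction by a fixed point, which an isomorphism must
  respect.\<close>

lemma ones_in_space: "(\<lambda>_. True) \<in> system_space V \<longleftrightarrow> \<not> syndetic_zeros V"
proof
  assume x: "(\<lambda>_. True) \<in> system_space V"
  show "\<not> syndetic_zeros V"
  proof
    assume "syndetic_zeros V"
    then obtain B where B: "\<And>i. \<exists>j\<le>B. \<not> V (i + j)" unfolding syndetic_zeros_def by blast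
    obtain k where k: "k \<ge> int B" "\<And>d. \<bar>d\<bar> \<le> int B \<Longrightarrow> True = V (nat (k + d))"
      using system_spaceE[OF x] by metis
    obtain j where "j \<le> B" "\<not> V (nat k + j)" using B by blast
    moreover have "nat k + j = nat (k + int j)" using k(1) by linarith
    ultimately show False using k(2)[of "int j"] by simp
  qed
next
  assume "\<not> syndetic_zeros V"
  then have B: "\<exists>i. \<forall>j\<le>B. V (i + j)" for B unfolding syndetic_zeros_def by blast
  show "(\<lambda>_. True) \<in> system_space V"
  proof (rule system_spaceI)
    fix M
    obtain i where i: "\<And>j. j \<le> 2 * M \<Longrightarrow> V (i + j)" using B by blast
    have "V (nat (int (i + M) + d))" if "\<bar>d\<bar> \<le> int M" for d
    proof -
      have "nat (int (i + M) + d) = i + nat (int M + d)" using that by linarith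
      then show ?thesis using i[of "nat (int M + d)"] that by simp
    qed
    then show "\<exists>k\<ge>int M. \<forall>d. \<bar>d\<bar> \<le> int M \<longrightarrow> True = V (nat (k + d))"
      by (intro exI[of _ "int (i + M)"]) auto
  qed
qed

context nd_word begin

text \<open>Both zeros lie in the same copy of the block. The equation is additive to avoid
  truncated subtraction of the two gaps.\<close>

lemma inner_gap:
  assumes b: "blocks V r" and t: "0 < n mod r"
  shows "zpos V n + zpos V (n mod r - 1) = zpos V (n - 1) + zpos V (n mod r)"
proof -
  define a t where "a = n div r" and "t = n mod r"
  have n: "n = r * a + t" "n - 1 = r * a + (t - 1)"
    using t by (simp_all add: a_def t_def mult_div_mod_eq add.commute)
  have lt: "t < r" using blocksD(1)[OF b] by (simp add: t_def)
  have "zpos V n = zpos V (r * a) + zpos V t"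
    using blocksD(2)[OF b lt, of a] n(1) by simp
  moreover have "zpos V (n - 1) = zpos V (r * a) + zpos V (t - 1)"
    unfolding n(2) by (rule blocksD(2)[OF b]) (use lt in simp)
  ultimately show ?thesis by (simp add: t_def)
qed

text \<open>Inside a block two neighbouring zeros are at most \<open>zpos V (r - 1)\<close> apart,
  so a run of that many ones separates blocks.\<close>

lemma start_after_ones:
  assumes b: "blocks V r" and k: "\<not> V k" and one: "\<And>j. j < k \<Longrightarrow> k \<le> j + zpos V (r - 1) \<Longrightarrow> V j"
  shows "k \<in> range (\<lambda>i. zpos V (r * i))"
proof -
  obtain n where n: "k = zpos V n" using k zero_iff by blast
  have "n mod r = 0"
  proof (rule ccontr)
    assume t: "n mod r \<noteq> 0"
    then have "n - 1 < n" by (cases n) auto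
    moreover have "n mod r \<le> r - 1" using mod_less_divisor[OF blocksD(1)[OF b], of n] by linarith
    then have "zpos V (n mod r) \<le> zpos V (r - 1)" by simp
    moreover from this have "k \<le> zpos V (n - 1) + zpos V (r - 1)"
      using inner_gap[OF b, of n] t unfolding n by linarith
    ultimately have "V (zpos V (n - 1))" using one[of "zpos V (n - 1)"] n by simp
    then show False by simp
  qed
  then show ?thesis using n by (auto simp: mod_eq_0_iff_dvd elim!: dvdE)
qed

lemma prefix_after_ones:
  assumes k: "\<not> V k" and n: "n \<le> zpos V (r - 1)" and b: "blocks V r"
    and one: "\<And>j. j < k \<Longrightarrow> k \<le> j + zpos V (r - 1) \<Longrightarrow> V j"
  shows "V (k + n) = V n"
proof -
  from start_after_ones[OF b k one] obtain i where "k = zpos V (r * i)" by blast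
  then show ?thesis using blocks_copy[OF inf b n] by blast
qed

text \<open>Non-degeneracy puts a 1 into \<open>V\<close>, hence into every copy of a long block,
  and each zero lies within a block length of such a 1. This excludes the second candidate for a
  fixed point.\<close>

lemma zeros_not_in_space: "(\<lambda>_. False) \<notin> system_space V"
proof
  assume x: "(\<lambda>_. False) \<in> system_space V"
  have "\<exists>j. V j"
  proof (rule ccontr)
    assume "\<not> ?thesis"
    then have "\<And>i. \<not> V i" by blast
    then have "zcount V n = n" "\<not> V n" for n by (simp_all add: zcount_def)
    then have "zpos V n = n" for n using zpos_eqI[OF inf] by blast
    moreover from this have "blocks V 1" by (simp add: blocks_def)
    ultimately show False using gaps_vary[of 1] by simp
  qed
  then obtain j where j: "V j" by blast
  obtain r where b: "blocks V r" and r: "j \<le> zpos V (r - 1)" using large_zp_blocks by blast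
  obtain k where k: "k \<ge> int (zpos V (r - 1))"
      "\<And>d. \<bar>d\<bar> \<le> int (zpos V (r - 1)) \<Longrightarrow> False = V (nat (k + d))"
    using system_spaceE[OF x] by metis
  obtain n where n: "nat k = zpos V n" using k(2)[of 0] zero_iff by auto
  have pd: "zpos V n = zpos V (r * (n div r)) + zpos V (n mod r)"
    using blocksD[OF b] by (metis mod_less_divisor mult_div_mod_eq)
  have "n mod r \<le> r - 1" using mod_less_divisor[OF blocksD(1)[OF b], of n] by linarith
  then have t: "zpos V (n mod r) \<le> zpos V (r - 1)" by simp
  have "V (zpos V (r * (n div r)) + j)" using blocks_copy[OF inf b r] j by simp
  moreover have "zpos V (r * (n div r)) + j = nat (k + (int j - int (zpos V (n mod r))))"
    using pd n k(1) t by linarith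
  moreover have "\<bar>int j - int (zpos V (n mod r))\<bar> \<le> int (zpos V (r - 1))" using r t by linarith
  ultimately show False using k(2) by simp
qed

lemma ones_then_word_in_space:
  assumes "\<not> syndetic_zeros V"
  shows "(\<lambda>i. i < 0 \<or> V (nat i)) \<in> system_space V"
proof (rule system_spaceI)
  fix M
  obtain r where b: "blocks V r" and r: "M \<le> zpos V (r - 1)" using large_zp_blocks by blast
  define q where "q = zpos V (r - 1)"
  obtain i where i: "\<And>j. j \<le> q \<Longrightarrow> V (i + j)"
    using assms unfolding syndetic_zeros_def by blast
  define k where "k = (LEAST k. i \<le> k \<and> \<not> V k)"
  have "\<exists>k. i \<le> k \<and> \<not> V k" using zpos_ge[of i] by (intro exI[of _ "zpos V i"]) simp
  from LeastI_ex[OF this] have k: "i \<le> k" "\<not> V k" unfolding k_def by auto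
  have one: "V j" if "i \<le> j" "j < k" for j
    using that not_less_Least[of j "\<lambda>k. i \<le> k \<and> \<not> V k"] unfolding k_def by blast
  have kq: "i + q < k" using k i[of "k - i"] by (metis le_add_diff_inverse not_less nat_add_left_cancel_le)
  have V: "V (k + n) = V n" if "n \<le> q" for n
    by (rule prefix_after_ones[OF k(2) _ b]) (use that one kq in \<open>auto simp: q_def\<close>)
  have "(d < 0 \<or> V (nat d)) = V (nat (int k + d))" if d: "\<bar>d\<bar> \<le> int M" for d
  proof (cases "d < 0")
    case True
    then have "i \<le> nat (int k + d)" "nat (int k + d) < k" using kq d r by (auto simp: q_def)
    then show ?thesis using one True by simp
  next
    case False
    then have "nat (int k + d) = k + nat d" "nat d \<le> q" using d r by (auto simp: q_def)
    then show ?thesis using V False by simp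
  qed
  then show "\<exists>k\<ge>int M. \<forall>d. \<bar>d\<bar> \<le> int M \<longrightarrow> (d < 0 \<or> V (nat d)) = V (nat (k + d))"
    using kq r by (intro exI[of _ "int k"]) (auto simp: q_def)
qed

text \<open>Ever larger windows around \<open>p\<close> show ever longer runs of ones before the
  zero, which force starts of arbitrarily long blocks.\<close>

lemma word_after_ones:
  assumes y: "y \<in> system_space V" and p: "\<not> y p" "\<And>i. i < p \<Longrightarrow> y i"
  shows "y (p + int n) = V n"
proof -
  obtain r where b: "blocks V r" and r: "n \<le> zpos V (r - 1)" using large_zp_blocks by blast
  obtain k where k: "k \<ge> int (zpos V (r - 1))"
      "\<And>d. \<bar>d\<bar> \<le> int (zpos V (r - 1)) \<Longrightarrow> y (p + d) = V (nat (k + d))"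
    using system_spaceE[OF y] by metis
  have "V (nat k + n) = V n"
  proof (rule prefix_after_ones[OF _ r b])
    show "\<not> V (nat k)" using k(2)[of 0] p by simp
    fix j assume j: "j < nat k" "nat k \<le> j + zpos V (r - 1)"
    then have "y (p + (int j - k)) = V (nat (k + (int j - k)))" by (intro k(2)) linarith
    moreover have "y (p + (int j - k))" by (rule p(2)) (use j in linarith)
    ultimately show "V j" by simp
  qed
  moreover have "nat k + n = nat (k + int n)" using k(1) by linarith
  ultimately show ?thesis using k(2)[of "int n"] r by simp
qed

end

section \<open>Asymptotic points\<close>

context nd_word begin

text \<open>Take two blocks preceded by gaps of different lengths: the zero before the shorter gap
  faces a one of the longer. The bound \<open>B\<close> does not depend on \<open>n\<close>, so the
  difference cannot escape when \<open>n\<close> grows and a limit is taken.\<close>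

lemma varying_past:
  assumes B: "\<And>i. \<exists>j\<le>B. \<not> V (i + j)"
  shows "\<exists>k k' g. n \<le> k \<and> n \<le> k' \<and> (\<forall>j\<le>n. V (k + j) = V j \<and> V (k' + j) = V j) \<and>
    g \<le> B \<and> g < k \<and> g < k' \<and> V (k - Suc g) \<noteq> V (k' - Suc g)"
proof -
  obtain r where b: "blocks V r" and r: "n + B + 1 \<le> zpos V (r - 1)" using large_zp_blocks by blast
  obtain i where i: "zpos V (r * Suc i) \<noteq> zpos V (r * i) + zpos V r" using gaps_vary[OF b] by blast
  have gap: "zpos V (Suc m) \<le> zpos V m + Suc B" for m
  proof -
    obtain j where j: "j \<le> B" "\<not> V (zpos V m + 1 + j)" using B by blast
    then obtain l where l: "zpos V m + 1 + j = zpos V l" using zero_iff by blast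
    then have "zpos V m < zpos V l" by linarith
    then have "zpos V (Suc m) \<le> zpos V l" by simp
    then show ?thesis using l j(1) by linarith
  qed
  define e where "e a = zpos V (r * Suc a)" for a
  define f where "f a = zpos V (r * a + (r - 1))" for a
  have f: "f a = zpos V (r * a) + zpos V (r - 1)" for a unfolding f_def blocks_last[OF b] ..
  have ef: "Suc (r * a + (r - 1)) = r * Suc a" for a using blocksD(1)[OF b] by (simp add: algebra_simps)
  have lt: "f a < e a" "e a \<le> f a + Suc B" for a
    using gap[of "r * a + (r - 1)"] zpos_less[THEN iffD2, OF lessI, of "r * a + (r - 1)"]
    unfolding ef e_def f_def by blast+
  have one: "V j" if "f a < j" "j < e a" for a j
    using zpos_gap[OF inf, of "r * a + (r - 1)" j] that unfolding ef e_def f_def by blast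
  have fz: "\<not> V (f a)" for a by (simp add: f_def)
  have ge: "n + B + 1 < e a" for a using lt(1)[of a] f[of a] r by linarith
  have pre: "V (e a + j) = V j" if "j \<le> n" for a j
    unfolding e_def by (rule blocks_copy[OF inf b]) (use that r in linarith)
  have main: "\<exists>g\<le>B. V (e a - Suc g) \<noteq> V (e a' - Suc g)" if "e a - f a < e a' - f a'" for a a'
  proof (intro exI conjI)
    show "e a - f a - 1 \<le> B" using lt(2)[of a] by linarith
    have "e a - Suc (e a - f a - 1) = f a" using lt(1)[of a] by linarith
    moreover have "V (e a' - Suc (e a - f a - 1))"
      by (rule one[of a']) (use that lt(1)[of a] lt(1)[of a'] in linarith)+
    ultimately show "V (e a - Suc (e a - f a - 1)) \<noteq> V (e a' - Suc (e a - f a - 1))" using fz by simp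
  qed
  have "e i \<noteq> zpos V (r * i) + e 0" using i by (simp add: e_def)
  then have "e i - f i \<noteq> e 0 - f 0"
    using f[of i] f[of 0] lt(1)[of i] lt(1)[of 0] by simp
  then obtain a a' where "e a - f a < e a' - f a'" by (metis linorder_neqE_nat)
  then obtain g where "g \<le> B" "V (e a - Suc g) \<noteq> V (e a' - Suc g)" using main by blast
  then show ?thesis using ge[of a] ge[of a'] pre
    by (intro exI[of _ "e a"] exI[of _ "e a'"] exI[of _ g]) auto
qed

lemma asymptotic_pair:
  assumes "syndetic_zeros V"
  obtains x x' where "x \<in> system_space V" "x' \<in> system_space V" "x \<noteq> x'"
    "\<And>n. x (int n) = V n" "\<And>n. x' (int n) = V n"
proof -
  obtain B where B: "\<And>i. \<exists>j\<le>B. \<not> V (i + j)" using assms unfolding syndetic_zeros_def by blast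
  have "\<forall>n. \<exists>k k' g. n \<le> k \<and> n \<le> k' \<and> (\<forall>j\<le>n. V (k + j) = V j \<and> V (k' + j) = V j) \<and>
    g \<le> B \<and> g < k \<and> g < k' \<and> V (k - Suc g) \<noteq> V (k' - Suc g)"
    using varying_past[OF B] by blast
  then obtain k k' g where K: "\<And>n. n \<le> k n \<and> n \<le> k' n \<and>
      (\<forall>j\<le>n. V (k n + j) = V j \<and> V (k' n + j) = V j) \<and>
      g n \<le> B \<and> g n < k n \<and> g n < k' n \<and> V (k n - Suc (g n)) \<noteq> V (k' n - Suc (g n))"
    by metis
  define f where "f k n i = V (nat (int (k n) + i))" for k :: "nat \<Rightarrow> nat" and n i
  obtain x s where s: "strict_mono s" and x: "\<And>i. \<forall>\<^sub>F n in sequentially. f k (s n) i = x i"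
    using pointwise_convergent_subsequence[of "f k"] by blast
  obtain x' s' where s': "strict_mono s'" and x': "\<And>i. \<forall>\<^sub>F n in sequentially. f k' (s (s' n)) i = x' i"
    using pointwise_convergent_subsequence[of "\<lambda>n. f k' (s n)"] by blast
  \<comment> \<open>Along this nested subsequence both families of translates converge.\<close>
  define t where "t n = s (s' n)" for n
  have t: "n \<le> t n" for n
    using strict_mono_imp_increasing[OF s] strict_mono_imp_increasing[OF s'] order_trans
    unfolding t_def by blast
  have lim: "\<forall>\<^sub>F n in sequentially. f k (t n) i = x i" for i
    using eventually_compose_filterlim[OF x filterlim_subseq[OF s']] unfolding t_def .
  have lim': "\<forall>\<^sub>F n in sequentially. f k' (t n) i = x' i" for i
    using x' unfolding t_def .
  have in_space: "y \<in> system_space V"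
    if l: "\<And>n. n \<le> l n" and y: "\<And>i. \<forall>\<^sub>F n in sequentially. f l (t n) i = y i" for l y
  proof (rule system_spaceI)
    fix M
    obtain n where n: "n \<ge> M" "\<And>d. \<bar>d\<bar> \<le> int M \<Longrightarrow> f l (t n) d = y d"
      using pointwise_window[of "\<lambda>n. f l (t n)" y M M] y by blast
    have "M \<le> l (t n)" using n(1) t[of n] l[of "t n"] by linarith
    then show "\<exists>k\<ge>int M. \<forall>d. \<bar>d\<bar> \<le> int M \<longrightarrow> y d = V (nat (k + d))"
      using n(2) by (intro exI[of _ "int (l (t n))"]) (auto simp: f_def)
  qed
  have word: "y (int m) = V m"
    if l: "\<And>n j. j \<le> n \<Longrightarrow> V (l n + j) = V j"
      and y: "\<And>i. \<forall>\<^sub>F n in sequentially. f l (t n) i = y i" for l y m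
  proof -
    obtain n where n: "n \<ge> m" "f l (t n) (int m) = y (int m)"
      using pointwise_window[of "\<lambda>n. f l (t n)" y m m] y by auto
    have "m \<le> t n" using n(1) t[of n] by linarith
    moreover have "nat (int (l (t n)) + int m) = l (t n) + m" by linarith
    ultimately show ?thesis using n(2) l by (simp add: f_def)
  qed
  have "x \<noteq> x'"
  proof
    assume eq: "x = x'"
    have "\<forall>\<^sub>F n in sequentially. f k (t n) i = f k' (t n) i" for i
      using lim[of i] lim'[of i] by eventually_elim (simp add: eq)
    then have "\<forall>\<^sub>F n in sequentially. \<forall>i\<in>{- int B - 1..0}. f k (t n) i = f k' (t n) i"
      by (intro eventually_ball_finite) auto
    from eventually_happens'[OF sequentially_bot this]
    obtain n where n: "\<And>i. i \<in> {- int B - 1..0} \<Longrightarrow> f k (t n) i = f k' (t n) i" by blast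
    let ?n = "t n"
    have "f k ?n (- int (Suc (g ?n))) = f k' ?n (- int (Suc (g ?n)))"
      by (rule n) (use K[of ?n] in auto)
    moreover have "nat (int (k ?n) + (- int (Suc (g ?n)))) = k ?n - Suc (g ?n)"
      "nat (int (k' ?n) + (- int (Suc (g ?n)))) = k' ?n - Suc (g ?n)"
      using K[of ?n] by linarith+
    ultimately show False using K[of ?n] unfolding f_def by simp
  qed
  moreover have "x \<in> system_space V" "x' \<in> system_space V"
    using in_space[of k x] in_space[of k' x'] lim lim' K by blast+
  moreover have "x (int m) = V m" "x' (int m) = V m" for m
    using word[of k x m] word[of k' x' m] lim lim' K by blast+
  ultimately show thesis using that by blast
qed

text \<open>At most \<open>r\<close> zeros lead to the next block start, and each gap costs at most
  \<open>Suc B\<close>. The distance \<open>h\<close> counts zeros, so that it can be carried over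
  to another parse.\<close>

lemma aligned_copy_near:
  assumes B: "\<And>i. \<exists>j\<le>B. \<not> V (i + j)"
  shows "\<exists>T. \<forall>u. \<exists>h. zpos V (u + h) + L \<le> zpos V u + T \<and> (\<forall>j<L. V (zpos V (u + h) + j) = V j)"
proof -
  obtain r where b: "blocks V r" and r: "L \<le> zpos V (r - 1)" using large_zp_blocks by blast
  have gap: "zpos V (u + h) \<le> zpos V u + h * Suc B" for u h
  proof (induction h)
    case (Suc h)
    obtain j where j: "j \<le> B" "\<not> V (zpos V (u + h) + 1 + j)" using B by blast
    then obtain l where l: "zpos V (u + h) + 1 + j = zpos V l" using zero_iff by blast
    then have "zpos V (u + h) < zpos V l" by linarith
    then have "zpos V (u + Suc h) \<le> zpos V l" by simp
    also have "\<dots> \<le> zpos V (u + h) + Suc B" using l j(1) by linarith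
    finally show ?case using Suc by simp
  qed simp
  have "\<exists>h. zpos V (u + h) + L \<le> zpos V u + (r * Suc B + L) \<and> (\<forall>j<L. V (zpos V (u + h) + j) = V j)" for u
  proof (intro exI conjI allI impI)
    let ?h = "r - u mod r"
    have "u mod r < r" using blocksD(1)[OF b] by simp
    then have h: "u + ?h = r * Suc (u div r)"
      using mult_div_mod_eq[of r u] unfolding mult_Suc_right by linarith
    have "zpos V (u + ?h) \<le> zpos V u + ?h * Suc B" by (rule gap)
    also have "\<dots> \<le> zpos V u + r * Suc B" by (intro add_left_mono mult_le_mono1) simp
    finally show "zpos V (u + ?h) + L \<le> zpos V u + (r * Suc B + L)" by simp
    fix j assume "j < L"
    then show "V (zpos V (u + ?h) + j) = V j"
      unfolding h using r by (intro blocks_copy[OF inf b]) linarith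
  qed
  then show ?thesis by blast
qed

text \<open>
  The parses of \<open>y\<close> and \<open>y'\<close> agree far to the right, hence are in phase at the first zero after
  \<open>q\<close>. The gap before that zero differs between \<open>y\<close> and \<open>y'\<close>, so it lies between blocks and a block
  starts at that zero, for block lengths as large as desired.
\<close>

lemma word_after_difference:
  assumes syn: "syndetic_zeros V"
    and y: "y \<in> system_space V" "y' \<in> system_space V"
    and q: "\<not> y q" "y' q" and eq: "\<And>i. q < i \<Longrightarrow> y i = y' i"
  shows "\<exists>p>q. \<forall>n. y (p + int n) = V n"
proof -
  obtain B where B: "\<And>i. \<exists>j\<le>B. \<not> V (i + j)" using syn unfolding syndetic_zeros_def by blast
  have "\<exists>n. \<not> y (q + 1 + int n)"
  proof -
    obtain k where k: "k \<ge> int (Suc B)" "\<And>d. \<bar>d\<bar> \<le> int (Suc B) \<Longrightarrow> y (q + d) = V (nat (k + d))"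
      using system_spaceE[OF y(1)] by metis
    obtain j where j: "j \<le> B" "\<not> V (nat (k + 1) + j)" using B by blast
    have "nat (k + 1) + j = nat (k + (1 + int j))" using k(1) by linarith
    then have "\<not> y (q + (1 + int j))" using k(2)[of "1 + int j"] j by simp
    then show ?thesis by (intro exI[of _ j]) (simp add: add.assoc)
  qed
  then obtain c where c: "\<not> y (q + 1 + int c)" "\<And>n. n < c \<Longrightarrow> y (q + 1 + int n)"
    using exists_least_iff[of "\<lambda>n. \<not> y (q + 1 + int n)"] by blast
  define d where "d = Suc c"
  have yd: "\<not> y (q + int d)" using c(1) by (simp add: d_def add.assoc)
  have yone: "y (q + int j)" if "0 < j" "j < d" for j
    using c(2)[of "j - 1"] that by (simp add: d_def add.assoc)
  \<comment> \<open>The position \<open>q + int d\<close> is the same for all \<open>n\<close>; only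
    the block length \<open>r\<close> and the windows depend on \<open>n\<close>.\<close>
  have "y (q + int d + int n) = V n" for n
  proof -
    obtain r where b: "blocks V r" and r: "n \<le> zpos V (r - 1)" using large_zp_blocks by blast
    obtain L where L: "\<And>k. (\<And>j. zpos V (r - 1) \<le> j \<Longrightarrow> j < L \<Longrightarrow> V (k + j) = V j) \<Longrightarrow>
        k \<in> range (\<lambda>i. zpos V (r * i))"
      using recognizable[OF b] by meson
    obtain T where T: "\<And>u. \<exists>h. zpos V (u + h) + Suc L \<le> zpos V u + T \<and>
        (\<forall>j<Suc L. V (zpos V (u + h) + j) = V j)"
      using aligned_copy_near[OF B, of "Suc L"] by blast
    define M where "M = d + T + n"
    obtain k where k: "k \<ge> int M" "\<And>i. \<bar>i\<bar> \<le> int M \<Longrightarrow> y (q + i) = V (nat (k + i))"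
      using system_spaceE[OF y(1)] by metis
    obtain k' where k': "k' \<ge> int M" "\<And>i. \<bar>i\<bar> \<le> int M \<Longrightarrow> y' (q + i) = V (nat (k' + i))"
      using system_spaceE[OF y(2)] by metis
    define K where "K = nat k"
    define K' where "K' = nat k'"
    have yK: "V (K + j) = y (q + int j)" if "j \<le> M" for j
    proof -
      have "nat (k + int j) = K + j" using k(1) by (simp add: K_def nat_add_distrib)
      then show ?thesis using k(2)[of "int j"] that by simp
    qed
    have yK': "V (K' + j) = y' (q + int j)" if "j \<le> M" for j
    proof -
      have "nat (k' + int j) = K' + j" using k'(1) by (simp add: K'_def nat_add_distrib)
      then show ?thesis using k'(2)[of "int j"] that by simp
    qed
    have same: "V (K' + j) = V (K + j)" if "0 < j" "j \<le> M" for j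
      using yK[OF that(2)] yK'[OF that(2)] eq[of "q + int j"] that by simp
    have d0: "0 < d" and dM: "d \<le> M" by (simp_all add: d_def M_def)
    have "\<not> V (K + d)" using yK[OF dM] yd by simp
    then obtain u where u: "K + d = zpos V u" using zero_iff by blast
    have "\<not> V (K' + d)" using same[OF d0 dM] \<open>\<not> V (K + d)\<close> by simp
    then obtain u' where u': "K' + d = zpos V u'" using zero_iff by blast
    have "\<not> V K" using yK[of 0] q by simp
    then obtain a where a: "K = zpos V a" using zero_iff by blast
    have "zpos V a < zpos V u" using u a d0 by linarith
    then have au: "a < u" by simp
    have "u - 1 = a"
    proof (rule ccontr)
      assume "u - 1 \<noteq> a"
      then have "a < u - 1" "u - 1 < u" using au by auto
      then have "zpos V a < zpos V (u - 1)" "zpos V (u - 1) < zpos V u" by simp_all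
      then have "0 < zpos V (u - 1) - K" "zpos V (u - 1) - K < d" "K + (zpos V (u - 1) - K) = zpos V (u - 1)"
        using a u by linarith+
      then have "V (zpos V (u - 1))"
        using yK[of "zpos V (u - 1) - K"] yone[of "zpos V (u - 1) - K"] dM by simp
      then show False by simp
    qed
    obtain h where h: "zpos V (u + h) + Suc L \<le> zpos V u + T" "\<And>j. j < Suc L \<Longrightarrow> V (zpos V (u + h) + j) = V j"
      using T[of u] by blast
    \<comment> \<open>The windows agree after \<open>q\<close>, so the same number \<open>h\<close>
      of zeros leads to the same place in both. As \<open>r\<close> will divide \<open>u + h\<close>
      and \<open>u' + h\<close>, the indices \<open>u\<close> and \<open>u'\<close> are in
      phase.\<close>
    have huh: "zpos V (u' + h) = K' + d + (zpos V (u + h) - (K + d))"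
    proof (rule zpos_transport[OF inf])
      show "V (K' + d + j) = V (K + d + j)" if "j < Suc T" for j
        using same[of "d + j"] that d0 by (simp add: M_def add.assoc)
      show "zpos V (u + h) < K + d + Suc T" using h(1) u by linarith
    qed (simp_all add: u u')
    have uh: "zpos V u \<le> zpos V (u + h)" by simp
    then have off: "zpos V (u + h) = K + (d + (zpos V (u + h) - (K + d)))"
      "zpos V (u' + h) = K' + (d + (zpos V (u + h) - (K + d)))" using huh u by linarith+
    have P: "zpos V (u + h) \<in> range (\<lambda>i. zpos V (r * i))" by (rule L) (use h(2) in simp)
    have "V (zpos V (u' + h) + j) = V (zpos V (u + h) + j)" if "j < L" for j
    proof -
      have "d + (zpos V (u + h) - (K + d)) + j \<le> M" using h(1) u uh that unfolding M_def by linarith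
      then show ?thesis
        using same[of "d + (zpos V (u + h) - (K + d)) + j"] d0 off by (simp add: add.assoc)
    qed
    then have P': "zpos V (u' + h) \<in> range (\<lambda>i. zpos V (r * i))" by (intro L) (use h(2) in simp)
    have "r dvd u + h" "r dvd u' + h" using P P' by auto
    then have mod: "u mod r = u' mod r"
      using dvd_diff_nat[of r "u' + h" "u + h"] dvd_diff_nat[of r "u + h" "u' + h"]
        mod_eq_dvd_iff_nat[of u u' r] mod_eq_dvd_iff_nat[of u' u r] by (cases "u \<le> u'") auto
    have "u mod r = 0"
    proof (rule ccontr)
      assume "u mod r \<noteq> 0"
      then have "zpos V u' - zpos V (u' - 1) = zpos V u - zpos V (u - 1)" "0 < u'"
        using inner_gap[OF b, of u] inner_gap[OF b, of u'] mod zpos_le[of "u' - 1" u'] zpos_le[of "u - 1" u]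
        by (auto intro: gr0I)
      moreover have "zpos V (u' - 1) \<le> zpos V u'" by simp
      moreover have "zpos V (u - 1) = K" using \<open>u - 1 = a\<close> a by simp
      ultimately have "zpos V (u' - 1) = K'" using u u' by linarith
      then have "\<not> V K'" using zpos_nonzero by metis
      then show False using yK'[of 0] q by simp
    qed
    then obtain s where "u = r * s" by auto
    then have "V (K + d + n) = V n" using blocks_copy[OF inf b r, of s] u by simp
    moreover have "V (K + (d + n)) = y (q + int (d + n))" by (rule yK) (simp add: M_def)
    ultimately show ?thesis by (simp add: add.assoc)
  qed
  then show ?thesis by (intro exI[of _ "q + int d"]) (simp add: d_def)
qed

text \<open>Apply \<open>word_after_difference\<close> at the last difference; whichever point has
  the 0 there, both agree afterwards.\<close>

lemma word_in_asymptotic_pair: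
  assumes syn: "syndetic_zeros V"
    and y: "y \<in> system_space V" "y' \<in> system_space V"
    and neq: "y \<noteq> y'" and eq: "\<And>i. m \<le> i \<Longrightarrow> y i = y' i"
  shows "\<exists>p. \<forall>n. y (p + int n) = V n"
proof -
  obtain j where j: "y j \<noteq> y' j" using neq by blast
  then have "j < m" using eq[of j] by linarith
  have "\<exists>n. y (m - int n) \<noteq> y' (m - int n)"
    using j \<open>j < m\<close> by (intro exI[of _ "nat (m - j)"]) simp
  then obtain c where c: "y (m - int c) \<noteq> y' (m - int c)"
      "\<And>n. n < c \<Longrightarrow> y (m - int n) = y' (m - int n)"
    using exists_least_iff[of "\<lambda>n. y (m - int n) \<noteq> y' (m - int n)"] by blast
  define q where "q = m - int c"
  have q: "y q \<noteq> y' q" using c(1) by (simp add: q_def)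
  have after: "y i = y' i" if "q < i" for i
  proof (cases "m \<le> i")
    case False
    then show ?thesis using c(2)[of "nat (m - i)"] that by (simp add: q_def)
  qed (use eq in blast)
  show ?thesis
  proof (cases "y q")
    case False
    then show ?thesis using word_after_difference[OF syn y, of q] q after by blast
  next
    case True
    then obtain p where p: "p > q" "\<And>n. y' (p + int n) = V n"
      using word_after_difference[OF syn y(2,1), of q] q after by blast
    then show ?thesis using after by (intro exI[of _ p]) simp
  qed
qed

end

section \<open>From an injective factor map to a replacement scheme\<close>

context factor_map begin

text \<open>The image of a fixed point is a fixed point, and the constant 0 is excluded.\<close>

lemma ones:
  assumes W: "nd_word W" and V: "(\<lambda>_. True) \<in> system_space V"
  shows "\<phi> (\<lambda>_. True) = (\<lambda>_. True)"
proof -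
  interpret W: nd_word W by fact
  let ?y = "\<phi> (\<lambda>_. True)"
  have "?y i = ?y 0" for i using translate[OF V, of i] by (metis add_0)
  then have "?y = (\<lambda>_. ?y 0)" by blast
  moreover have "?y \<noteq> (\<lambda>_. False)" using maps[OF V] W.zeros_not_in_space by auto
  ultimately show ?thesis by (metis (full_types))
qed

text \<open>Injectivity keeps the image of \<open>x\<close> distinct from that of its asymptotic
  partner, which is a second point ending in \<open>V\<close> or the constant 1. The results on
  asymptotic points then find \<open>W\<close> in the image.\<close>

lemma anchor:
  assumes VW: "nd_word V" "nd_word W" and inj: "inj_on \<phi> (system_space V)"
    and syn: "syndetic_zeros V \<Longrightarrow> syndetic_zeros W"
  obtains x p where "x \<in> system_space V" "\<And>n. x (int n) = V n" "\<And>n. \<phi> x (p + int n) = W n"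
proof -
  interpret V: nd_word V by fact
  interpret W: nd_word W by fact
  obtain N where "sliding (system_space V) N \<phi>" using sliding_exists by blast
  note N = slidingD[OF this]
  show thesis
  proof (cases "syndetic_zeros V")
    case True
    obtain x x' where x: "x \<in> system_space V" "x' \<in> system_space V" "x \<noteq> x'"
        "\<And>n. x (int n) = V n" "\<And>n. x' (int n) = V n"
      using V.asymptotic_pair[OF True] by blast
    have neq: "\<phi> x \<noteq> \<phi> x'" using inj_onD[OF inj] x(1-3) by blast
    have "\<phi> x i = \<phi> x' i" if "int N \<le> i" for i
    proof (rule N[OF x(1,2)])
      fix d :: int assume "\<bar>d\<bar> \<le> int N"
      then show "x (i + d) = x' (i + d)" using x(4,5)[of "nat (i + d)"] that
        by (simp split: if_splits)
    qed
    then obtain p where "\<And>n. \<phi> x (p + int n) = W n"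
      using W.word_in_asymptotic_pair[OF syn[OF True] maps[OF x(1)] maps[OF x(2)] neq] by blast
    then show thesis using that x by blast
  next
    case False
    define x where "x i \<longleftrightarrow> i < 0 \<or> V (nat i)" for i :: int
    have x: "x \<in> system_space V" using V.ones_then_word_in_space[OF False] by (simp add: x_def[abs_def])
    have one: "(\<lambda>_. True) \<in> system_space V" using False ones_in_space by blast
    have left: "\<phi> x i" if "i < - int N" for i
    proof -
      have "\<phi> x i = \<phi> (\<lambda>_. True) i" by (rule N[OF x one]) (use that in \<open>auto simp: x_def\<close>)
      then show ?thesis using ones[OF VW(2) one] by simp
    qed
    have "x \<noteq> (\<lambda>_. True)" using V.start by (auto simp: x_def fun_eq_iff intro!: exI[of _ 0])
    then have "\<phi> x \<noteq> (\<lambda>_. True)" using inj_onD[OF inj _ x one] ones[OF VW(2) one] by auto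
    then obtain j where j: "\<not> \<phi> x j" by blast
    \<comment> \<open>Left of \<open>- int N\<close> the image has only ones, so its zeros can be
      searched from there and a first one exists.\<close>
    then have "\<exists>n. \<not> \<phi> x (int n - int N)"
      using left[of j] by (intro exI[of _ "nat (j + int N)"]) (cases "j < - int N"; simp)
    then obtain c where c: "\<not> \<phi> x (int c - int N)" "\<And>n. n < c \<Longrightarrow> \<phi> x (int n - int N)"
      using exists_least_iff[of "\<lambda>n. \<not> \<phi> x (int n - int N)"] by blast
    have "\<phi> x i" if "i < int c - int N" for i
      using left[of i] c(2)[of "nat (i + int N)"] that by (cases "i < - int N") auto
    then have "\<phi> x (int c - int N + int n) = W n" for n
      using W.word_after_ones[OF maps[OF x] c(1)] by blast
    moreover have "x (int n) = V n" for n by (simp add: x_def)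
    ultimately show thesis using that x by blast
  qed
qed

lemma replacement_scheme_exists:
  assumes VW: "nd_word V" "nd_word W" and inj: "inj_on \<phi> (system_space V)"
    and syn: "syndetic_zeros V \<Longrightarrow> syndetic_zeros W"
  shows "\<exists>v w. replacement_scheme V W v w"
proof -
  obtain N where "sliding (system_space V) N \<phi>" using sliding_exists by blast
  note N = slidingD[OF this]
  obtain x p where x: "x \<in> system_space V" "\<And>n. x (int n) = V n" "\<And>n. \<phi> x (p + int n) = W n"
    using anchor[OF assms] by blast
  obtain B where B: "syndetic_zeros V \<Longrightarrow> \<forall>i. \<exists>j\<le>B. \<not> V (i + j)"
    unfolding syndetic_zeros_def by blast
  \<comment> \<open>The summand \<open>nat \<bar>p\<bar>\<close> makes the window of
    \<open>V\<close> of radius \<open>M\<close> cover the coordinates that the code reads at the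
    shifted position. The summand \<open>B\<close> makes a window of ones impossible if the zeros of
    \<open>V\<close> are syndetic; otherwise \<open>B\<close> is arbitrary.\<close>
  define M where "M = N + nat \<bar>p\<bar> + B"
  have window: "x (p + int (i + M) + d) = V (i + nat (p + int M + d))" "nat (p + int M + d) \<le> 2 * M"
    if "\<bar>d\<bar> \<le> int N" for i d
  proof -
    have "p + int (i + M) + d = int (i + nat (p + int M + d))"
      using that unfolding M_def by linarith
    then show "x (p + int (i + M) + d) = V (i + nat (p + int M + d))" by (simp only: x(2))
    have "int M = int N + \<bar>p\<bar> + int B" by (simp add: M_def)
    then show "nat (p + int M + d) \<le> 2 * M" using that unfolding nat_le_iff by linarith
  qed
  show ?thesis
  proof (rule replacement_scheme_of_local_rule[OF VW, of M])
    fix i i' assume "\<And>j. j \<le> 2 * M \<Longrightarrow> V (i + j) = V (i' + j)"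
    then have "\<phi> x (p + int (i + M)) = \<phi> x (p + int (i' + M))"
      by (intro N[OF x(1) x(1)]) (simp only: window)
    then show "W (i + M) = W (i' + M)" by (simp only: x(3))
  next
    fix i assume one: "\<And>j. j \<le> 2 * M \<Longrightarrow> V (i + j)"
    have "\<not> syndetic_zeros V"
    proof
      assume "syndetic_zeros V"
      then obtain j where "j \<le> B" "\<not> V (i + j)" using B by blast
      then show False using one[of j] by (simp add: M_def)
    qed
    then have ones_in: "(\<lambda>_. True) \<in> system_space V" using ones_in_space by blast
    have "\<phi> x (p + int (i + M)) = \<phi> (\<lambda>_. True) 0"
      by (rule N[OF x(1) ones_in]) (simp only: window one)
    then show "W (i + M)" using ones[OF VW(2) ones_in] by (simp only: x(3))
  qed
qed

end

theorem corollary3p7: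
  fixes V W :: "nat \<Rightarrow> bool"
  assumes "rank_one V" and "\<not> degenerate V"
    and "rank_one W" and "\<not> degenerate W"
  shows "isomorphic_systems (system_space V) (system_space W) \<longleftrightarrow>
    (\<exists>v w. replacement_scheme V W v w)"
proof
  have V: "nd_word V" and W: "nd_word W" using assms nd_wordI by blast+
  {
    assume "\<exists>v w. replacement_scheme V W v w"
    then show "isomorphic_systems (system_space V) (system_space W)"
      using isomorphic_if_replacement_scheme[OF V W] by blast
  next
    assume "isomorphic_systems (system_space V) (system_space W)"
    then obtain \<phi> \<psi> where h: "homeomorphism (system_space V) (system_space W) \<phi> \<psi>"
        and eq: "\<forall>x\<in>system_space V. \<phi> (shift x) = shift (\<phi> x)"
      unfolding isomorphic_systems_def by blast
    interpret \<phi>: factor_map V W \<phi>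
    proof
      show "continuous_on (system_space V) \<phi>" using h by (simp add: homeomorphism_def)
      show "\<phi> x \<in> system_space W" if "x \<in> system_space V" for x
        using h that by (auto simp: homeomorphism_def)
    qed (use eq in blast)
    have inv: "\<psi> (\<phi> x) = x" if "x \<in> system_space V" for x
      using h that by (simp add: homeomorphism_def)
    have inv': "\<phi> (\<psi> y) = y" "\<psi> y \<in> system_space V" if "y \<in> system_space W" for y
      using h that by (auto simp: homeomorphism_def)
    interpret \<psi>: factor_map W V \<psi>
    proof
      show "continuous_on (system_space W) \<psi>" using h by (simp add: homeomorphism_def)
      show "\<psi> y \<in> system_space V" if "y \<in> system_space W" for y by (rule inv'(2)[OF that])
      fix y assume y: "y \<in> system_space W"
      have s: "shift (\<psi> y) \<in> system_space V"
        using translate_in_space[OF inv'(2)[OF y], of 1] by (simp add: shift_def)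
      have "\<phi> (shift (\<psi> y)) = shift y" using eq inv'[OF y] by simp
      then show "\<psi> (shift y) = shift (\<psi> y)" using inv[OF s] by simp
    qed
    \<comment> \<open>This is what the inverse as a factor map is for: it would carry the constant
      point 1 of the second system to that of the first.\<close>
    have "syndetic_zeros W" if "syndetic_zeros V"
    proof (rule ccontr)
      assume "\<not> ?thesis"
      then have one: "(\<lambda>_. True) \<in> system_space W" using ones_in_space by blast
      then have "(\<lambda>_. True) \<in> system_space V" using \<psi>.maps[OF one] \<psi>.ones[OF V one] by simp
      then show False using that ones_in_space by blast
    qed
    moreover have "inj_on \<phi> (system_space V)" by (rule inj_on_inverseI[of _ \<psi>]) (rule inv)
    ultimately show "\<exists>v w. replacement_scheme V W v w"
      using \<phi>.replacement_scheme_exists[OF V W] by blast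
  }
qed

end
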